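(* Let $X=\{X(u):u\in\mathbb{S}^2\}$ be an isotropic Gaussian random field on $\mathbb{S}^2$ with fractal index $\alpha\in(0,2]$. Consider the random surface $$Z_c=\{(u,X_c(u)):u\in\mathbb{S}^2\},$$ where $X_c(u)=\max(c,X(u))$ with $c>0$. Then with probability one either of the following alternatives holds: (a) If $\max_{u\in\mathbb{S}^2}X(u)\le c$, the realisation of $Z_c$ is the sphere with radius $c$ and so its Hausdorff dimension is $2$. (b) If $\max_{u\in\mathbb{S}^2}X(u)>c$, the realisation of $Z_c$ has Hausdorff dimension $3-\frac{\alpha}{2}$.
   Context: $\mathbb{S}^2=\{x\in\mathbb{R}^3:\|x\|=1\}$ is the unit sphere, and $d(u,v)=\arccos(u\cdot v)\in[0,\pi]$ is the great circle distance. A Gaussian random field $X$ on $\mathbb{S}^2$ (all finite-dimensional distributions Gaussian) is isotropic if its mean is constant, its variance is a constant $\sigma_X^2>0$, and there is a function $C:[0,\pi]\to\mathbb{R}$, the correlation function of $X$, with $\mathrm{Corr}(X(u_1),X(u_2))=C(d(u_1,u_2))$ for all $u_1,u_2\in\mathbb{S}^2$. The field $X$ has fractal index $\alpha>0$ if there is a constant $b>0$ such that $$\lim_{\theta\downarrow0}\frac{C(0)-C(\theta)}{\theta^\alpha}=b.$$ The surface $Z_c$ is regarded as a subset of $\mathbb{S}^2\times\mathbb{R}\subset\mathbb{R}^3\times\mathbb{R}$ with the Euclidean metric; the pair $(u,r)$ represents the point at distance $r$ from the origin in direction $u$. The Hausdorff dimension of a set $Z\subset\mathbb{R}^d$ is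 the unique $\delta_0\ge 0$ such that $H^\delta(Z)=\infty$ for $\delta<\delta_0$ and $H^\delta(Z)=0$ for $\delta>\delta_0$, where $H^\delta(Z)=\lim_{\epsilon\to0}\inf\{\sum_i|B_i|^\delta\}$, the infimum being over countable covers of $Z$ by balls $B_i\subset\mathbb{R}^d$ of diameters $|B_i|\le\epsilon$.
   Formalization: The field X is additionally assumed to have almost surely continuous sample paths; without this the claim fails, since changing X at one independent random point keeps all finite-dimensional distributions but can push the maximum above c while the dimension of Z_c stays 2. *)

theory Defs
  imports "HOL-Probability.Probability"
begin

section \<open>Hausdorff measure and Hausdorff dimension\<close>

definition fine_ball_covers :: "real \<Rightarrow> 'a::euclidean_space set \<Rightarrow> 'a set set set" where
  "fine_ball_covers \<epsilon> Z =
     {\<B>. countable \<B> \<and> (\<forall>B\<in>\<B>. (\<exists>x r. r > 0 \<and> B = ball x r) \<and> diameter B \<le> \<epsilon>) \<and> Z \<subseteq> \<Union>\<B>}"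

definition hausdorff_premeasure :: "real \<Rightarrow> real \<Rightarrow> 'a::euclidean_space set \<Rightarrow> ennreal" where
  "hausdorff_premeasure \<delta> \<epsilon> Z =
     (INF \<B>\<in>fine_ball_covers \<epsilon> Z. \<Sum>\<^sub>\<infinity>B\<in>\<B>. ennreal (diameter B powr \<delta>))"

definition hausdorff_measure :: "real \<Rightarrow> 'a::euclidean_space set \<Rightarrow> ennreal" where
  "hausdorff_measure \<delta> Z = Lim (at_right 0) (\<lambda>\<epsilon>. hausdorff_premeasure \<delta> \<epsilon> Z)"

definition has_hausdorff_dim :: "'a::euclidean_space set \<Rightarrow> real \<Rightarrow> bool"
    (infix \<open>has'_hausdorff'_dim\<close> 50) where
  "Z has_hausdorff_dim \<delta>\<^sub>0 \<longleftrightarrow> \<delta>\<^sub>0 \<ge> 0 \<and>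
     (\<forall>\<delta>\<ge>0. (\<delta> < \<delta>\<^sub>0 \<longrightarrow> hausdorff_measure \<delta> Z = \<infinity>) \<and> (\<delta> > \<delta>\<^sub>0 \<longrightarrow> hausdorff_measure \<delta> Z = 0))"

text \<open>The limit defining the Hausdorff measure always exists, and the dimension is unique.\<close>

lemma hausdorff_premeasure_antimono:
  assumes "\<epsilon> \<le> \<epsilon>'"
  shows "hausdorff_premeasure \<delta> \<epsilon>' Z \<le> hausdorff_premeasure \<delta> \<epsilon> Z"
  unfolding hausdorff_premeasure_def
proof (rule INF_superset_mono)
  show "fine_ball_covers \<epsilon> Z \<subseteq> fine_ball_covers \<epsilon>' Z"
    unfolding fine_ball_covers_def using assms by fastforce
qed simp

lemma tendsto_hausdorff_measure:
  "((\<lambda>\<epsilon>. hausdorff_premeasure \<delta> \<epsilon> Z) \<longlongrightarrow> hausdorff_measure \<delta> Z) (at_right 0)"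
proof -
  let ?h = "\<lambda>\<epsilon>. hausdorff_premeasure \<delta> \<epsilon> Z"
  have lim: "(?h \<longlongrightarrow> (SUP \<epsilon>\<in>{0<..}. ?h \<epsilon>)) (at_right 0)"
  proof (rule order_tendstoI)
    fix a assume "a < (SUP \<epsilon>\<in>{0<..}. ?h \<epsilon>)"
    then obtain e where e: "e > 0" "a < ?h e"
      by (auto simp: less_SUP_iff)
    have "a < ?h x" if "x < e" for x
      using e(2) hausdorff_premeasure_antimono[of x e] that by (meson less_imp_le less_le_trans)
    then show "\<forall>\<^sub>F x in at_right 0. a < ?h x"
      using e(1) by (auto simp: eventually_at_right_field)
  next
    fix a assume a: "(SUP \<epsilon>\<in>{0<..}. ?h \<epsilon>) < a"
    have "?h x < a" if "x > 0" for x
      using SUP_upper[of x "{0<..}" ?h] a that by auto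
    then show "\<forall>\<^sub>F x in at_right 0. ?h x < a"
      by (auto simp: eventually_at_right_field intro: exI[of _ 1])
  qed
  then show ?thesis
    unfolding hausdorff_measure_def by (metis tendsto_Lim trivial_limit_at_right_real)
qed

lemma has_hausdorff_dim_unique:
  assumes "Z has_hausdorff_dim s" "Z has_hausdorff_dim t"
  shows "s = t"
proof -
  have False if xy: "x < y" "Z has_hausdorff_dim x" "Z has_hausdorff_dim y" for x y
  proof -
    obtain z where z: "x < z" "z < y" using dense[OF xy(1)] by blast
    moreover have "x \<ge> 0" using xy(2) by (simp add: has_hausdorff_dim_def)
    ultimately have "z \<ge> 0" by linarith
    then have "hausdorff_measure z Z = 0" "hausdorff_measure z Z = \<infinity>"
      using xy(2,3) z unfolding has_hausdorff_dim_def by blast+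
    then show False by simp
  qed
  from this[of s t] this[of t s] assms show ?thesis by (cases s t rule: linorder_cases) auto
qed

section \<open>Gaussian random fields\<close>

text \<open>Degenerate Gaussian laws are included: the covariance matrices of a Gaussian field may be
  singular.\<close>

definition gaussian_measure :: "real measure \<Rightarrow> bool" where
  "gaussian_measure \<nu> \<longleftrightarrow>
     (\<exists>\<mu>. \<nu> = return borel \<mu>) \<or> (\<exists>\<mu> \<sigma>. \<sigma> > 0 \<and> \<nu> = density lborel (normal_density \<mu> \<sigma>))"

definition multivariate_gaussian :: "'i set \<Rightarrow> ('i \<Rightarrow> real) measure \<Rightarrow> bool" where
  "multivariate_gaussian F \<nu> \<longleftrightarrow>
     (\<forall>a. gaussian_measure (distr \<nu> borel (\<lambda>x. \<Sum>i\<in>F. a i * x i)))"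

definition gaussian_field :: "'w measure \<Rightarrow> 'i set \<Rightarrow> ('i \<Rightarrow> 'w \<Rightarrow> real) \<Rightarrow> bool" where
  "gaussian_field M T X \<longleftrightarrow>
     (\<forall>t\<in>T. X t \<in> borel_measurable M) \<and>
     (\<forall>F. finite F \<and> F \<subseteq> T \<longrightarrow>
        multivariate_gaussian F (distr M (Pi\<^sub>M F (\<lambda>_. borel)) (\<lambda>\<omega>. \<lambda>t\<in>F. X t \<omega>)))"

definition covariance :: "'w measure \<Rightarrow> ('w \<Rightarrow> real) \<Rightarrow> ('w \<Rightarrow> real) \<Rightarrow> real" where
  "covariance M Y Y' = prob_space.expectation M
     (\<lambda>\<omega>. (Y \<omega> - prob_space.expectation M Y) * (Y' \<omega> - prob_space.expectation M Y'))"

definition correlation :: "'w measure \<Rightarrow> ('w \<Rightarrow> real) \<Rightarrow> ('w \<Rightarrow> real) \<Rightarrow> real" where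
  "correlation M Y Y' =
     covariance M Y Y' / sqrt (prob_space.variance M Y * prob_space.variance M Y')"

section \<open>Isotropic fields on the sphere\<close>

abbreviation S2 :: "(real^3) set" where
  "S2 \<equiv> sphere 0 1"

definition great_circle_dist :: "real^3 \<Rightarrow> real^3 \<Rightarrow> real" where
  "great_circle_dist u v = arccos (u \<bullet> v)"

text \<open>Since the great circle distance takes all values in \<open>[0, \<pi>]\<close>, a correlation function is
  determined on \<open>[0, \<pi>]\<close> by the field; its values elsewhere are irrelevant.\<close>

definition correlation_function ::
    "'w measure \<Rightarrow> (real^3 \<Rightarrow> 'w \<Rightarrow> real) \<Rightarrow> (real \<Rightarrow> real) \<Rightarrow> bool" where
  "correlation_function M X C \<longleftrightarrow>
     (\<forall>u\<in>S2. \<forall>v\<in>S2. correlation M (X u) (X v) = C (great_circle_dist u v))"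

definition isotropic :: "'w measure \<Rightarrow> (real^3 \<Rightarrow> 'w \<Rightarrow> real) \<Rightarrow> bool" where
  "isotropic M X \<longleftrightarrow>
     (\<exists>m. \<forall>u\<in>S2. prob_space.expectation M (X u) = m) \<and>
     (\<exists>\<sigma>>0. \<forall>u\<in>S2. prob_space.variance M (X u) = \<sigma>\<^sup>2) \<and>
     (\<exists>C. correlation_function M X C)"

definition has_fractal_index :: "'w measure \<Rightarrow> (real^3 \<Rightarrow> 'w \<Rightarrow> real) \<Rightarrow> real \<Rightarrow> bool" where
  "has_fractal_index M X \<alpha> \<longleftrightarrow> \<alpha> > 0 \<and>
     (\<exists>C b. correlation_function M X C \<and> b > 0 \<and>
        ((\<lambda>\<theta>. (C 0 - C \<theta>) / \<theta> powr \<alpha>) \<longlongrightarrow> b) (at_right 0))"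

text \<open>\<open>truncated_surface c x\<close> is the surface \<open>Z\<^sub>c\<close> of a realisation \<open>x\<close> of the field. The product
  type \<open>(real^3) \<times> real\<close> carries the Euclidean metric.\<close>

definition truncated_surface :: "real \<Rightarrow> (real^3 \<Rightarrow> real) \<Rightarrow> ((real^3) \<times> real) set" where
  "truncated_surface c x = (\<lambda>u. (u, max c (x u))) ` S2"

definition radial_point :: "(real^3) \<times> real \<Rightarrow> real^3" where
  "radial_point = (\<lambda>(u, r). r *\<^sub>R u)"

end

theory Submission
  imports Defs
begin

text \<open>In spherical coordinates the field is studied on a rectangle. Upper bound: the increments are
  Gaussian with variance at most a constant times \<open>dist u v powr \<alpha>\<close>, so chaining over dyadic grids
  makes the paths Hoelder continuous of every order \<open>\<gamma> < \<alpha> / 2\<close>, and covering the surface above each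
  dyadic square gives dimension at most \<open>3 - \<gamma>\<close>. Lower bound: for \<open>1 < s < 3 - \<alpha> / 2\<close> the
  \<open>s\<close>-energy of the graph over a small rectangle has finite expectation, because a Gaussian has
  negative moments of every order \<open>- p > - 1\<close>; hence almost surely the graph over every small rational
  rectangle has dimension at least \<open>s\<close>. If the maximum exceeds \<open>c\<close>, continuity provides a rational
  rectangle on which truncation does nothing.\<close>

section \<open>Hausdorff measure: covers and energy\<close>

text \<open>The value 3 - \<alpha> / 2 comes from splitting the energy kernel. A distance on the
  graph dominates both the chord h and the height difference, so its power -s is at most h^-(s-p)
  times the height difference to the power -p. Expectation turns the second factor into a multiple
  of h^(-\<alpha> p / 2), and in two dimensions h^-\<beta> with \<beta> = s - p + \<alpha> p / 2 is
  integrable for \<beta> < 2. As p approaches 1, the reachable s fill up everything below 3 -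
  \<alpha> / 2. On the other side, 4^n squares with about 2^((1-\<gamma>)n) balls of size 2^-n each
  give the exponent 3 - \<gamma>, where \<gamma> is free below \<alpha> / 2. Two obstacles shape the
  details. Every almost sure statement has a null set that depends on the exponent, so the exponents
  must run through the rationals before any limit is taken. And \<open>0 powr x = 0\<close>: a
  singular kernel vanishes on the diagonal instead of being infinite, so wherever a negative power
  is estimated, coincidences have to be excluded or shown to be null.\<close>

lemma infsum_cmult_ennreal:
  fixes f :: "'b \<Rightarrow> ennreal"
  shows "(\<Sum>\<^sub>\<infinity>x\<in>A. c * f x) = c * infsum f A"
proof -
  have "c * infsum f A = (SUP F\<in>{F. finite F \<and> F \<subseteq> A}. c * sum f F)"
    by (simp add: nonneg_infsum_complete SUP_mult_left_ennreal)
  also have "\<dots> = infsum (\<lambda>x. c * f x) A"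
    by (simp add: nonneg_infsum_complete sum_distrib_left)
  finally show ?thesis by simp
qed

text \<open>Countable subadditivity for the unordered sums of \<open>hausdorff_premeasure\<close>.
  An enumeration turns an infinite index set into a sequence, and each partial sum is one of the
  finite sums whose supremum is the unordered sum.\<close>

lemma emeasure_UN_le_infsum:
  assumes "countable I" "\<And>i. i \<in> I \<Longrightarrow> W i \<in> sets M"
  shows "emeasure M (\<Union>i\<in>I. W i) \<le> (\<Sum>\<^sub>\<infinity>i\<in>I. emeasure M (W i))"
proof (cases "finite I")
  case True
  then show ?thesis using assms emeasure_subadditive_finite[of I W M] by auto
next
  case False
  let ?f = "from_nat_into I"
  have bij: "bij_betw ?f UNIV I" using assms(1) False by (rule bij_betw_from_nat_into)
  have mem: "?f n \<in> I" for n using bij by (auto simp: bij_betw_def)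
  have "(\<Union>i\<in>I. W i) = (\<Union>n. W (?f n))" using bij by (force simp: bij_betw_def)
  then have "emeasure M (\<Union>i\<in>I. W i) \<le> (\<Sum>n. emeasure M (W (?f n)))"
    using assms(2) mem by (auto intro!: emeasure_subadditive_countably)
  also have "\<dots> \<le> (\<Sum>\<^sub>\<infinity>i\<in>I. emeasure M (W i))"
  proof (rule suminf_le_const)
    fix n
    have "(\<Sum>k<n. emeasure M (W (?f k))) = (\<Sum>i\<in>?f ` {..<n}. emeasure M (W i))"
      using bij by (subst sum.reindex) (auto simp: bij_betw_def inj_on_def)
    also have "\<dots> \<le> (\<Sum>\<^sub>\<infinity>i\<in>I. emeasure M (W i))"
      using mem by (subst nonneg_infsum_complete) (auto intro!: SUP_upper)
    finally show "(\<Sum>k<n. emeasure M (W (?f k))) \<le> (\<Sum>\<^sub>\<infinity>i\<in>I. emeasure M (W i))" .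
  qed simp
  finally show ?thesis .
qed

lemma hausdorff_premeasure_le_measure:
  assumes "\<epsilon> > 0"
  shows "hausdorff_premeasure \<delta> \<epsilon> Z \<le> hausdorff_measure \<delta> Z"
proof (rule tendsto_lowerbound[OF tendsto_hausdorff_measure])
  have "hausdorff_premeasure \<delta> \<epsilon> Z \<le> hausdorff_premeasure \<delta> y Z" if "y < \<epsilon>" for y
    by (rule hausdorff_premeasure_antimono) (use that in simp)
  then show "\<forall>\<^sub>F y in at_right 0. hausdorff_premeasure \<delta> \<epsilon> Z \<le> hausdorff_premeasure \<delta> y Z"
    unfolding eventually_at_right_field using assms by (intro exI[of _ \<epsilon>]) simp
qed simp

lemma hausdorff_measure_eq_0I:
  fixes Z :: "'a::euclidean_space set"
  assumes "\<And>\<epsilon> e. \<epsilon> > 0 \<Longrightarrow> e > 0 \<Longrightarrow>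
    \<exists>\<B>\<in>fine_ball_covers \<epsilon> Z. (\<Sum>\<^sub>\<infinity>B\<in>\<B>. ennreal (diameter B powr \<delta>)) \<le> ennreal e"
  shows "hausdorff_measure \<delta> Z = 0"
proof -
  have zero: "hausdorff_premeasure \<delta> \<epsilon> Z = 0" if "\<epsilon> > 0" for \<epsilon>
  proof -
    have "hausdorff_premeasure \<delta> \<epsilon> Z \<le> 0"
    proof (rule ennreal_le_epsilon)
      fix e :: real assume "e > 0"
      with assms[OF that] obtain \<B> where \<B>: "\<B> \<in> fine_ball_covers \<epsilon> Z"
        and le: "(\<Sum>\<^sub>\<infinity>B\<in>\<B>. ennreal (diameter B powr \<delta>)) \<le> ennreal e" by blast
      show "hausdorff_premeasure \<delta> \<epsilon> Z \<le> 0 + ennreal e"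
        unfolding hausdorff_premeasure_def add_0 using \<B> le by (rule INF_lower2)
    qed
    then show ?thesis by simp
  qed
  have "\<forall>\<^sub>F \<epsilon> in at_right (0::real). hausdorff_premeasure \<delta> \<epsilon> Z = 0"
    unfolding eventually_at_right_field by (intro exI[of _ 1]) (simp add: zero)
  then have "((\<lambda>\<epsilon>. hausdorff_premeasure \<delta> \<epsilon> Z) \<longlongrightarrow> 0) (at_right 0)"
    by (rule tendsto_eventually)
  from tendsto_unique[OF _ tendsto_hausdorff_measure this] show ?thesis by simp
qed

text \<open>Lowering the exponent from \<open>s\<close> to \<open>\<delta>\<close> multiplies each
  term by at least \<open>\<epsilon> powr (\<delta> - s)\<close> when all diameters are at most
  \<open>\<epsilon>\<close>, and this factor is unbounded as \<open>\<epsilon>\<close> tends to 0. A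
  positive lower bound at exponent \<open>s\<close>, uniform over covers, is thereby amplified to
  infinity.\<close>

lemma hausdorff_measure_eq_top_of_cover_bound:
  fixes Z :: "'a::euclidean_space set"
  assumes "\<kappa> > 0" "\<delta> < s"
    and le: "\<And>\<B>. \<B> \<in> fine_ball_covers 1 Z \<Longrightarrow>
      ennreal \<kappa> \<le> (\<Sum>\<^sub>\<infinity>B\<in>\<B>. ennreal (diameter B powr s))"
  shows "hausdorff_measure \<delta> Z = \<infinity>"
proof -
  have ge: "ennreal (\<kappa> * \<epsilon> powr (\<delta> - s)) \<le> hausdorff_measure \<delta> Z" if \<epsilon>: "0 < \<epsilon>" "\<epsilon> \<le> 1" for \<epsilon>
  proof -
    have "ennreal (\<kappa> * \<epsilon> powr (\<delta> - s)) \<le> (\<Sum>\<^sub>\<infinity>B\<in>\<B>. ennreal (diameter B powr \<delta>))"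
      if \<B>: "\<B> \<in> fine_ball_covers \<epsilon> Z" for \<B>
    proof -
      have "\<B> \<in> fine_ball_covers 1 Z"
        using \<B> \<epsilon> unfolding fine_ball_covers_def by fastforce
      from le[OF this] have "ennreal (\<kappa> * \<epsilon> powr (\<delta> - s)) \<le>
          ennreal (\<epsilon> powr (\<delta> - s)) * (\<Sum>\<^sub>\<infinity>B\<in>\<B>. ennreal (diameter B powr s))"
        using assms(1) by (subst mult.commute) (simp add: ennreal_mult' mult_left_mono)
      also have "\<dots> = (\<Sum>\<^sub>\<infinity>B\<in>\<B>. ennreal (\<epsilon> powr (\<delta> - s)) * ennreal (diameter B powr s))"
        by (rule infsum_cmult_ennreal[symmetric])
      also have "\<dots> \<le> (\<Sum>\<^sub>\<infinity>B\<in>\<B>. ennreal (diameter B powr \<delta>))"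
      proof (rule infsum_mono)
        fix B assume "B \<in> \<B>"
        then obtain x r where B: "r > 0" "B = ball x r" "diameter B \<le> \<epsilon>"
          using \<B> unfolding fine_ball_covers_def by blast
        then have d: "diameter B > 0" by simp
        have "\<epsilon> powr (\<delta> - s) \<le> diameter B powr (\<delta> - s)"
          using d B(3) assms(2) by (intro powr_mono2') auto
        then have "\<epsilon> powr (\<delta> - s) * diameter B powr s \<le> diameter B powr (\<delta> - s) * diameter B powr s"
          by (intro mult_right_mono) auto
        also have "\<dots> = diameter B powr \<delta>"
          by (simp add: powr_add[symmetric])
        finally show "ennreal (\<epsilon> powr (\<delta> - s)) * ennreal (diameter B powr s) \<le> ennreal (diameter B powr \<delta>)"
          by (simp add: ennreal_mult'[symmetric] ennreal_leI)
      qed (auto intro: nonneg_summable_on_complete)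
      finally show ?thesis .
    qed
    then have "ennreal (\<kappa> * \<epsilon> powr (\<delta> - s)) \<le> hausdorff_premeasure \<delta> \<epsilon> Z"
      unfolding hausdorff_premeasure_def by (intro INF_greatest)
    then show ?thesis
      using hausdorff_premeasure_le_measure[OF \<epsilon>(1)] order_trans by blast
  qed
  show ?thesis
  proof (rule ccontr)
    assume "hausdorff_measure \<delta> Z \<noteq> \<infinity>"
    then obtain R where R: "R \<ge> 0" "hausdorff_measure \<delta> Z = ennreal R"
      by (cases "hausdorff_measure \<delta> Z") auto
    define t where "t = s - \<delta>"
    have t: "t > 0" using assms(2) by (simp add: t_def)
    \<comment> \<open>Chosen so that
      \<open>\<kappa> * \<epsilon> powr (\<delta> - s) = \<kappa> + R\<close>, which exceeds the
      supposed value \<open>R\<close>.\<close>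
    define \<epsilon> where "\<epsilon> = (1 + R / \<kappa>) powr (- 1 / t)"
    have pos: "1 + R / \<kappa> \<ge> 1" using R assms by simp
    have "0 < \<epsilon>" "\<epsilon> \<le> 1"
      using pos t powr_mono2'[of "- 1 / t" 1 "1 + R / \<kappa>"] by (auto simp: \<epsilon>_def)
    from ge[OF this] have le: "\<kappa> * \<epsilon> powr (\<delta> - s) \<le> R" using R by simp
    have "\<epsilon> powr (\<delta> - s) = 1 + R / \<kappa>"
    proof -
      have "(- 1 / t) * (\<delta> - s) = 1" using t by (simp add: t_def field_simps)
      then show ?thesis unfolding \<epsilon>_def powr_powr using pos by simp
    qed
    with le have "\<kappa> * (1 + R / \<kappa>) \<le> R" by simp
    moreover have "\<kappa> * (1 + R / \<kappa>) = \<kappa> + R" using assms(1) by (simp add: field_simps)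
    ultimately show False using assms(1) by linarith
  qed
qed

text \<open>Mass distribution principle, with the measure kept on the parameter space of
  \<open>G\<close>. If a covering ball contains some \<open>G x\<close> with \<open>x\<close> in
  \<open>A\<close>, all of it is within its own diameter of \<open>G x\<close>, so its preimage in
  \<open>A\<close> has mass at most \<open>N\<close> times the diameter to the power
  \<open>s\<close>; summing over the cover recovers the mass of \<open>A\<close>.\<close>

lemma hausdorff_measure_eq_top_of_mass_distribution:
  fixes G :: "'p \<Rightarrow> 'a::euclidean_space"
  assumes [measurable]: "G \<in> borel_measurable \<mu>" "A \<in> sets \<mu>"
    and A: "emeasure \<mu> A > 0"
    and GZ: "G ` space \<mu> \<subseteq> Z"
    and N: "N \<ge> 0" "\<And>x r. x \<in> A \<Longrightarrow> r > 0 \<Longrightarrow>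
      emeasure \<mu> {y \<in> space \<mu>. dist (G x) (G y) \<le> r} \<le> ennreal (N * r powr s)"
    and "\<delta> < s"
  shows "hausdorff_measure \<delta> Z = \<infinity>"
proof -
  have bound: "emeasure \<mu> A \<le> ennreal N * (\<Sum>\<^sub>\<infinity>B\<in>\<B>. ennreal (diameter B powr s))"
    if \<B>: "\<B> \<in> fine_ball_covers 1 Z" for \<B>
  proof -
    have cnt: "countable \<B>" using \<B> by (simp add: fine_ball_covers_def)
    have balls: "\<exists>x r. r > 0 \<and> B = ball x r" if "B \<in> \<B>" for B
      using \<B> that by (simp add: fine_ball_covers_def)
    define W where "W B = {y \<in> A. G y \<in> B}" for B
    have W[measurable]: "W B \<in> sets \<mu>" if "B \<in> \<B>" for B
    proof -
      have [measurable]: "B \<in> sets borel" using balls[OF that] by auto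
      have "W B = A \<inter> {y \<in> space \<mu>. G y \<in> B}"
        using sets.sets_into_space[OF assms(2)] by (auto simp: W_def)
      also have "\<dots> \<in> sets \<mu>" by measurable
      finally show ?thesis .
    qed
    have W_le: "emeasure \<mu> (W B) \<le> ennreal N * ennreal (diameter B powr s)" if B: "B \<in> \<B>" for B
    proof (cases "W B = {}")
      case False
      then obtain x where x: "x \<in> A" "G x \<in> B" by (auto simp: W_def)
      obtain c r where cr: "r > 0" "B = ball c r" using balls[OF B] by blast
      have d: "diameter B > 0" and bB: "bounded B" using cr by auto
      have "emeasure \<mu> (W B) \<le> emeasure \<mu> {y \<in> space \<mu>. dist (G x) (G y) \<le> diameter B}"
      proof (rule emeasure_mono)
        show "W B \<subseteq> {y \<in> space \<mu>. dist (G x) (G y) \<le> diameter B}"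
          using diameter_bounded_bound[OF bB x(2)] sets.sets_into_space[OF assms(2)]
          by (auto simp: W_def)
      qed measurable
      also have "\<dots> \<le> ennreal (N * diameter B powr s)" by (rule N(2)[OF x(1) d])
      finally show ?thesis using N(1) by (simp add: ennreal_mult')
    qed simp
    have "A \<subseteq> (\<Union>B\<in>\<B>. W B)"
    proof
      fix x assume x: "x \<in> A"
      then have "G x \<in> Z"
        using GZ sets.sets_into_space[OF assms(2)] by blast
      then have "G x \<in> \<Union>\<B>"
        using \<B> unfolding fine_ball_covers_def by blast
      then show "x \<in> (\<Union>B\<in>\<B>. W B)" using x by (auto simp: W_def)
    qed
    then have "emeasure \<mu> A \<le> emeasure \<mu> (\<Union>B\<in>\<B>. W B)"
      using cnt by (intro emeasure_mono sets.countable_UN') auto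
    also have "\<dots> \<le> (\<Sum>\<^sub>\<infinity>B\<in>\<B>. emeasure \<mu> (W B))"
      using cnt W by (rule emeasure_UN_le_infsum)
    also have "\<dots> \<le> ennreal N * (\<Sum>\<^sub>\<infinity>B\<in>\<B>. ennreal (diameter B powr s))"
      unfolding infsum_cmult_ennreal[symmetric]
      using W_le by (intro infsum_mono nonneg_summable_on_complete) auto
    finally show ?thesis .
  qed
  \<comment> \<open>The mass of \<open>A\<close> may be infinite, so a positive real number below it
    is fixed.\<close>
  obtain a where a: "a > 0" "ennreal a \<le> emeasure \<mu> A"
  proof (cases "emeasure \<mu> A")
    case (real r)
    then show ?thesis using A that[of r] by simp
  next
    case top
    then show ?thesis using that[of 1] by simp
  qed
  \<comment> \<open>Since \<open>N\<close> may be 0, the quotient is formed with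
    \<open>N + 1\<close>.\<close>
  show ?thesis
  proof (rule hausdorff_measure_eq_top_of_cover_bound[of "a / (N + 1)", OF _ \<open>\<delta> < s\<close>])
    show "a / (N + 1) > 0" using a N(1) by simp
    fix \<B> assume "\<B> \<in> fine_ball_covers 1 Z"
    then have "ennreal a \<le> ennreal N * (\<Sum>\<^sub>\<infinity>B\<in>\<B>. ennreal (diameter B powr s))"
      using bound by (intro order_trans[OF a(2)])
    also have "\<dots> \<le> ennreal (N + 1) * (\<Sum>\<^sub>\<infinity>B\<in>\<B>. ennreal (diameter B powr s))"
      using N(1) by (intro mult_right_mono ennreal_leI) auto
    finally have le: "ennreal a \<le> ennreal (N + 1) * (\<Sum>\<^sub>\<infinity>B\<in>\<B>. ennreal (diameter B powr s))" .
    show "ennreal (a / (N + 1)) \<le> (\<Sum>\<^sub>\<infinity>B\<in>\<B>. ennreal (diameter B powr s))"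
    proof (cases "\<Sum>\<^sub>\<infinity>B\<in>\<B>. ennreal (diameter B powr s)")
      case (real t)
      then have "ennreal a \<le> ennreal ((N + 1) * t)"
        using le N(1) by (simp only: ennreal_mult)
      then have "a \<le> (N + 1) * t"
        using real N(1) by (subst (asm) ennreal_le_iff) auto
      then have "a / (N + 1) \<le> t"
        using N(1) by (simp add: divide_le_eq mult.commute)
      then show ?thesis unfolding real by (rule ennreal_leI)
    qed simp
  qed
qed

text \<open>Finite energy makes the potential \<open>F\<close> finite almost everywhere, so it is
  bounded by some \<open>n\<close> on a set \<open>A n\<close> of positive mass; there Markov's
  inequality gives the growth \<open>n * r powr s\<close> that the mass distribution principle asks
  for. Because \<open>0 powr (- s) = 0\<close>, the kernel does not see the points with
  \<open>G y = G x\<close>; the hypothesis \<open>null\<close> ensures that they carry no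
  mass.\<close>

lemma hausdorff_measure_eq_top_of_energy:
  fixes G :: "'p \<Rightarrow> 'a::euclidean_space"
  assumes "sigma_finite_measure \<mu>"
    and [measurable]: "G \<in> borel_measurable \<mu>"
    and pos: "emeasure \<mu> (space \<mu>) > 0"
    and null: "\<And>x. x \<in> space \<mu> \<Longrightarrow> AE y in \<mu>. G y \<noteq> G x"
    and energy: "(\<integral>\<^sup>+x. \<integral>\<^sup>+y. ennreal (dist (G x) (G y) powr (- s)) \<partial>\<mu> \<partial>\<mu>) < \<infinity>"
    and GZ: "G ` space \<mu> \<subseteq> Z" and s: "\<delta> < s" "s > 0"
  shows "hausdorff_measure \<delta> Z = \<infinity>"
proof -
  interpret sigma_finite_measure \<mu> by fact
  define F where "F x = (\<integral>\<^sup>+y. ennreal (dist (G x) (G y) powr (- s)) \<partial>\<mu>)" for x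
  have [measurable]: "F \<in> borel_measurable \<mu>" unfolding F_def by measurable
  define A where "A n = {x \<in> space \<mu>. F x \<le> ennreal (real n)}" for n :: nat
  have [measurable]: "A n \<in> sets \<mu>" for n unfolding A_def by measurable
  obtain n where n: "emeasure \<mu> (A n) > 0"
  proof (rule ccontr)
    assume "\<not> thesis"
    then have "\<And>n. emeasure \<mu> (A n) = 0" using that by (auto simp: zero_less_iff_neq_zero)
    then have "emeasure \<mu> (\<Union>n. A n) = 0" by (intro emeasure_UN_eq_0) auto
    then have 1: "AE x in \<mu>. x \<notin> (\<Union>n. A n)" by (intro AE_not_in) auto
    have "AE x in \<mu>. F x \<noteq> \<infinity>"
      using energy by (intro nn_integral_PInf_AE) (auto simp: F_def)
    with 1 have "AE x in \<mu>. False"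
    proof (rule AE_mp[OF _ AE_mp], intro AE_I2 impI)
      fix x assume x: "x \<in> space \<mu>" "F x \<noteq> \<infinity>" "x \<notin> (\<Union>n. A n)"
      then obtain k :: nat where "F x \<le> of_nat k"
        using ennreal_Ex_less_of_nat[of "F x"] by (auto simp: less_top intro: less_imp_le)
      then show False using x by (auto simp: A_def ennreal_of_nat_eq_real_of_nat)
    qed
    then show False using pos by (simp add: AE_iff_measurable[of "space \<mu>"])
  qed
  show ?thesis
  proof (rule hausdorff_measure_eq_top_of_mass_distribution[where N = "real n" and s = s and A = "A n" and G = G and \<mu> = \<mu>])
    fix x r assume x: "x \<in> A n" and r: "(r::real) > 0"
    have xs: "x \<in> space \<mu>" using x by (simp add: A_def)
    have "emeasure \<mu> {y \<in> space \<mu>. dist (G x) (G y) \<le> r}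
        = (\<integral>\<^sup>+y. indicator {y \<in> space \<mu>. dist (G x) (G y) \<le> r} y \<partial>\<mu>)"
      by (subst nn_integral_indicator) auto
    also have "\<dots> \<le> (\<integral>\<^sup>+y. ennreal (r powr s) * ennreal (dist (G x) (G y) powr (- s)) \<partial>\<mu>)"
    proof (rule nn_integral_mono_AE)
      from null[OF xs] show "AE y in \<mu>. indicator {y \<in> space \<mu>. dist (G x) (G y) \<le> r} y
          \<le> ennreal (r powr s) * ennreal (dist (G x) (G y) powr (- s))"
      proof (rule AE_mp, intro AE_I2 impI)
        fix y assume "G y \<noteq> G x"
        then have d: "dist (G x) (G y) > 0" by simp
        have "1 \<le> r powr s * dist (G x) (G y) powr (- s)" if "dist (G x) (G y) \<le> r"
          using powr_mono2[of s "dist (G x) (G y)" r] d that s by (simp add: powr_minus field_simps)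
        then show "indicator {y \<in> space \<mu>. dist (G x) (G y) \<le> r} y
          \<le> ennreal (r powr s) * ennreal (dist (G x) (G y) powr (- s))"
          by (auto simp: indicator_def ennreal_mult'[symmetric])
      qed
    qed
    also have "\<dots> = ennreal (r powr s) * F x"
      unfolding F_def by (rule nn_integral_cmult) measurable
    also have "\<dots> \<le> ennreal (r powr s) * ennreal (real n)"
      using x by (intro mult_left_mono) (auto simp: A_def)
    finally show "emeasure \<mu> {y \<in> space \<mu>. dist (G x) (G y) \<le> r} \<le> ennreal (real n * r powr s)"
      by (simp add: ennreal_mult' mult.commute)
  qed (use n GZ s in auto)
qed

section \<open>Spherical coordinates\<close>

text \<open>Polar angle \<open>a\<close> from the third axis, azimuth \<open>b\<close>. The map is
  kept on the whole plane, so it is continuous everywhere and grid points beyond the coordinate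
  range still land on the sphere.\<close>

definition sph :: "real \<times> real \<Rightarrow> real^3" where
  "sph = (\<lambda>(a, b). vector [sin a * cos b, sin a * sin b, cos a])"

lemma sph_nth:
  "sph (a, b) $ 1 = sin a * cos b" "sph (a, b) $ 2 = sin a * sin b" "sph (a, b) $ 3 = cos a"
  by (simp_all add: sph_def)

lemma sph_inner:
  "sph (a, b) \<bullet> sph (a', b') = cos (a - a') - sin a * sin a' * (1 - cos (b - b'))"
  by (simp add: inner_vec_def sum_3 sph_nth cos_diff algebra_simps)

lemma one_minus_cos: "1 - cos x = 2 * (sin (x / 2))\<^sup>2" for x :: real
  using cos_double_sin[of "x / 2"] by simp

text \<open>The haversine formula for the chord. The factor \<open>sin a * sin a'\<close> of its
  second term shows how the chart degenerates at the poles.\<close>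

lemma sph_dist_sq:
  "(dist (sph (a, b)) (sph (a', b')))\<^sup>2 =
     4 * (sin ((a - a') / 2))\<^sup>2 + 4 * (sin a * sin a') * (sin ((b - b') / 2))\<^sup>2"
proof -
  have self: "sph (x, y) \<bullet> sph (x, y) = 1" for x y by (simp add: sph_inner)
  have "(dist (sph (a, b)) (sph (a', b')))\<^sup>2 = 2 - 2 * (sph (a, b) \<bullet> sph (a', b'))"
    by (simp add: dist_norm power2_norm_eq_inner inner_diff_left inner_diff_right self inner_commute)
  also have "\<dots> = 2 * (1 - cos (a - a')) + 2 * (sin a * sin a') * (1 - cos (b - b'))"
    by (simp add: sph_inner algebra_simps)
  finally show ?thesis by (simp add: one_minus_cos)
qed

lemma sph_in_S2: "sph p \<in> S2"
proof (cases p)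
  case (Pair a b)
  have "sph (a, b) \<bullet> sph (a, b) = 1" by (simp add: sph_inner)
  then show ?thesis by (simp add: Pair norm_eq_1)
qed

lemma sin_sq_le: "(sin x)\<^sup>2 \<le> x\<^sup>2" for x :: real
  using abs_sin_x_le_abs_x[of x] by (simp add: abs_le_square_iff)

lemma sph_dist_le: "dist (sph p) (sph q) \<le> dist p q"
proof -
  obtain a b a' b' where pq: "p = (a, b)" "q = (a', b')" by (cases p, cases q)
  have "sin a * sin a' \<le> 1"
    using abs_sin_le_one[of a] abs_sin_le_one[of a'] mult_le_one[of "\<bar>sin a\<bar>" "\<bar>sin a'\<bar>"]
    by (simp add: abs_mult[symmetric])
  then have "4 * (sin a * sin a') * (sin ((b - b') / 2))\<^sup>2 \<le> 4 * (sin ((b - b') / 2))\<^sup>2"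
    by (simp add: mult_left_le_one_le mult_right_mono)
  then have "(dist (sph p) (sph q))\<^sup>2 \<le> (a - a')\<^sup>2 + (b - b')\<^sup>2"
    using sin_sq_le[of "(a - a') / 2"] sin_sq_le[of "(b - b') / 2"]
    unfolding pq sph_dist_sq by (simp add: power_divide)
  also have "\<dots> = (dist p q)\<^sup>2"
    by (simp add: pq dist_Pair_Pair dist_real_def)
  finally show ?thesis by (rule power2_le_imp_le) simp
qed

lemma continuous_on_sph [continuous_intros]: "continuous_on A sph"
proof (rule lipschitz_on_continuous_on)
  show "1-lipschitz_on A sph" by (rule lipschitz_onI) (simp_all add: sph_dist_le)
qed

text \<open>Jordan's inequality: sine is concave on \<open>{0..pi / 2}\<close>, so it lies above the
  chord from the origin to \<open>(pi / 2, 1)\<close>.\<close>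

lemma sin_half_ge:
  fixes x :: real assumes "\<bar>x\<bar> \<le> pi" shows "x\<^sup>2 \<le> pi\<^sup>2 * (sin (x / 2))\<^sup>2"
proof -
  have "\<bar>x\<bar> / pi \<le> sin (\<bar>x\<bar> / 2)"
  proof -
    have "convex_on {0..pi / 2} (\<lambda>y. - sin y)"
      by (rule f''_ge0_imp_convex[where f' = "\<lambda>y. - cos y" and f'' = sin])
         (auto intro!: derivative_eq_intros sin_ge_zero)
    from convex_onD_Icc'[OF this, of "\<bar>x\<bar> / 2"] show ?thesis using assms by (simp add: field_simps)
  qed
  then have "\<bar>x\<bar> \<le> \<bar>pi * sin (\<bar>x\<bar> / 2)\<bar>"
    using abs_ge_self[of "pi * sin (\<bar>x\<bar> / 2)"] by (simp add: field_simps)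
  then have "x\<^sup>2 \<le> (pi * sin (\<bar>x\<bar> / 2))\<^sup>2" by (metis abs_le_square_iff)
  also have "\<dots> = pi\<^sup>2 * (sin (x / 2))\<^sup>2" by (cases "x \<ge> 0") (auto simp: power_mult_distrib)
  finally show ?thesis .
qed

text \<open>A lower Lipschitz bound away from the poles: with both sines at least \<open>k\<close>,
  the azimuth term of the haversine formula keeps a factor \<open>k\<^sup>2\<close>, and
  \<open>k \<le> 1\<close> allows the same factor in the polar term. Jordan's inequality bounds the
  half-angle sines below.\<close>

lemma sph_dist_ge:
  assumes "\<bar>a - a'\<bar> \<le> pi" "\<bar>b - b'\<bar> \<le> pi" "0 \<le> k" "k \<le> 1" "k \<le> sin a" "k \<le> sin a'"
  shows "k * max \<bar>a - a'\<bar> \<bar>b - b'\<bar> \<le> pi * dist (sph (a, b)) (sph (a', b'))"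
proof -
  have k2: "k\<^sup>2 \<le> sin a * sin a'" "k\<^sup>2 \<le> 1"
    using assms by (auto simp: power2_eq_square intro: mult_mono mult_le_one)
  have "k\<^sup>2 * (a - a')\<^sup>2 \<le> pi\<^sup>2 * (sin ((a - a') / 2))\<^sup>2"
    using sin_half_ge[OF assms(1)] k2(2) mult_right_mono[of "k\<^sup>2" 1 "(a - a')\<^sup>2"] by simp
  moreover have "k\<^sup>2 * (b - b')\<^sup>2 \<le> (sin a * sin a') * (pi\<^sup>2 * (sin ((b - b') / 2))\<^sup>2)"
    using sin_half_ge[OF assms(2)] k2(1) assms by (intro mult_mono) auto
  moreover have "0 \<le> pi\<^sup>2 * (sin ((a - a') / 2))\<^sup>2" by simp
  moreover have "0 \<le> (sin a * sin a') * (pi\<^sup>2 * (sin ((b - b') / 2))\<^sup>2)"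
    using assms by (intro mult_nonneg_nonneg) auto
  moreover have "(pi * dist (sph (a, b)) (sph (a', b')))\<^sup>2 = 4 * (pi\<^sup>2 * (sin ((a - a') / 2))\<^sup>2) +
      4 * ((sin a * sin a') * (pi\<^sup>2 * (sin ((b - b') / 2))\<^sup>2))"
    unfolding power_mult_distrib sph_dist_sq by (simp add: algebra_simps)
  ultimately have "(k * \<bar>a - a'\<bar>)\<^sup>2 \<le> (pi * dist (sph (a, b)) (sph (a', b')))\<^sup>2"
    "(k * \<bar>b - b'\<bar>)\<^sup>2 \<le> (pi * dist (sph (a, b)) (sph (a', b')))\<^sup>2"
    unfolding power_mult_distrib power2_abs by linarith+
  then have "k * \<bar>a - a'\<bar> \<le> pi * dist (sph (a, b)) (sph (a', b'))"
    "k * \<bar>b - b'\<bar> \<le> pi * dist (sph (a, b)) (sph (a', b'))"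
    by (auto intro: power2_le_imp_le)
  then show ?thesis by (auto simp: max_def)
qed

lemma sph_surj:
  assumes "u \<in> S2"
  obtains a b where "0 \<le> a" "a \<le> pi" "0 \<le> b" "b < 2 * pi" "u = sph (a, b)"
proof -
  have n: "(u $ 1)\<^sup>2 + (u $ 2)\<^sup>2 + (u $ 3)\<^sup>2 = 1"
    using assms by (simp add: norm_eq_1 inner_vec_def sum_3 power2_eq_square)
  then have u3: "-1 \<le> u $ 3" "u $ 3 \<le> 1"
    using abs_square_le_1[of "u $ 3"] zero_le_power2[of "u $ 1"] zero_le_power2[of "u $ 2"]
    by (smt (verit))+
  define a where "a = arccos (u $ 3)"
  have a: "0 \<le> a" "a \<le> pi" "cos a = u $ 3"
    using u3 by (auto simp: a_def arccos_lbound arccos_ubound)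
  have sa: "sin a \<ge> 0" using a by (intro sin_ge_zero)
  have s2: "(u $ 1)\<^sup>2 + (u $ 2)\<^sup>2 = (sin a)\<^sup>2" using n a(3) sin_squared_eq[of a] by simp
  obtain b where b: "0 \<le> b" "b < 2 * pi" "u $ 1 = sin a * cos b" "u $ 2 = sin a * sin b"
  proof (cases "sin a = 0")
    case True
    then have "u $ 1 = 0" "u $ 2 = 0" using s2 by simp_all
    then show ?thesis using that[of 0] True by simp
  next
    case False
    then have "(u $ 1 / sin a)\<^sup>2 + (u $ 2 / sin a)\<^sup>2 = 1"
      using s2 by (simp add: power_divide add_divide_distrib[symmetric])
    from sincos_total_2pi[OF this] obtain t where "0 \<le> t" "t < 2 * pi" "u $ 1 / sin a = cos t" "u $ 2 / sin a = sin t"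
      by metis
    then show ?thesis using that[of t] False by (simp add: field_simps)
  qed
  have "u = sph (a, b)"
    by (simp add: vec_eq_iff forall_3 sph_nth a b)
  then show ?thesis using that a b by blast
qed

text \<open>The chord of an arc \<open>t \<le> pi\<close> is \<open>2 * sin (t / 2)\<close>, which
  lies between \<open>2 * t / pi\<close> and \<open>t\<close>. This translates the behaviour of
  \<open>C\<close> at small angles into Euclidean distances.\<close>

lemma great_circle_dist_bounds:
  assumes "u \<in> S2" "v \<in> S2"
  shows "dist u v \<le> great_circle_dist u v" "great_circle_dist u v \<le> pi / 2 * dist u v"
proof -
  have n: "norm u = 1" "norm v = 1" using assms by auto
  have uv: "\<bar>u \<bullet> v\<bar> \<le> 1" using Cauchy_Schwarz_ineq2[of u v] n by simp
  define t where "t = great_circle_dist u v"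
  have t: "0 \<le> t" "t \<le> pi" "cos t = u \<bullet> v"
    using uv by (auto simp: t_def great_circle_dist_def arccos_lbound arccos_ubound)
  have d: "(dist u v)\<^sup>2 = 4 * (sin (t / 2))\<^sup>2"
    using n one_minus_cos[of t]
    by (simp add: dist_norm power2_norm_eq_inner inner_diff_left inner_diff_right inner_commute
        t(3) norm_eq_1)
  have "(dist u v)\<^sup>2 \<le> t\<^sup>2" using d sin_sq_le[of "t / 2"] by (simp add: power_divide)
  then show "dist u v \<le> great_circle_dist u v" using t(1) by (auto simp: t_def intro: power2_le_imp_le)
  have "t\<^sup>2 \<le> (pi / 2 * dist u v)\<^sup>2"
    using sin_half_ge[of t] t(1,2) by (simp add: power_mult_distrib d power_divide)
  then show "great_circle_dist u v \<le> pi / 2 * dist u v"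
    unfolding t_def by (rule power2_le_imp_le) simp
qed

lemma sph_continuous_comp:
  assumes "continuous_on S2 x" shows "continuous_on UNIV (\<lambda>p. x (sph p))"
  by (rule continuous_on_compose2[OF assms continuous_on_sph]) (use sph_in_S2 in blast)

section \<open>Gaussian increments\<close>

lemma gaussian_field_linear_combination:
  assumes "gaussian_field M T X" "finite F" "F \<subseteq> T"
  shows "gaussian_measure (distr M borel (\<lambda>\<omega>. \<Sum>i\<in>F. a i * X i \<omega>))"
proof -
  have X[measurable]: "X i \<in> borel_measurable M" if "i \<in> F" for i
    using assms that by (auto simp: gaussian_field_def)
  have [measurable]: "(\<lambda>\<omega>. \<lambda>t\<in>F. X t \<omega>) \<in> measurable M (Pi\<^sub>M F (\<lambda>_. borel))"
    by (intro measurable_restrict X)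
  have "gaussian_measure (distr (distr M (Pi\<^sub>M F (\<lambda>_. borel)) (\<lambda>\<omega>. \<lambda>t\<in>F. X t \<omega>)) borel
      (\<lambda>x. \<Sum>i\<in>F. a i * x i))"
    using assms unfolding gaussian_field_def multivariate_gaussian_def by blast
  then show ?thesis
    by (subst (asm) distr_distr) (simp_all add: comp_def cong: sum.cong)
qed

lemma gaussian_field_increment:
  assumes "gaussian_field M T X" "u \<in> T" "v \<in> T"
  shows "gaussian_measure (distr M borel (\<lambda>\<omega>. X u \<omega> - X v \<omega>))"
proof (cases "u = v")
  \<comment> \<open>For \<open>u = v\<close> the index set \<open>{u, v}\<close> is a singleton, so
    the coefficients 1 and -1 cannot both be used; the zero combination serves instead.\<close>
  case True
  then show ?thesis
    using gaussian_field_linear_combination[OF assms(1), of "{u}" "\<lambda>_. 0"] assms by simp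
next
  case False
  then show ?thesis
    using gaussian_field_linear_combination[OF assms(1), of "{u, v}" "\<lambda>i. if i = u then 1 else -1"] assms
    by simp
qed

lemma gaussian_field_variable:
  assumes "gaussian_field M T X" "u \<in> T"
  shows "gaussian_measure (distr M borel (X u))"
  using gaussian_field_linear_combination[OF assms(1), of "{u}" "\<lambda>_. 1"] assms by simp

section \<open>Second moments, even moments and negative moments of a Gaussian variable\<close>

lemma (in prob_space) gaussian_cases:
  assumes "gaussian_measure (distr M borel Y)" and [measurable]: "Y \<in> borel_measurable M"
  obtains (const) \<mu> where "AE \<omega> in M. Y \<omega> = \<mu>"
    | (normal) \<mu> \<sigma> where "\<sigma> > 0" "distributed M lborel Y (normal_density \<mu> \<sigma>)"
proof -
  consider \<mu> where "distr M borel Y = return borel \<mu>"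
    | \<mu> \<sigma> where "\<sigma> > 0" "distr M borel Y = density lborel (normal_density \<mu> \<sigma>)"
    using assms(1) unfolding gaussian_measure_def by blast
  then show thesis
  proof cases
    case (1 \<mu>)
    have "AE y in distr M borel Y. y = \<mu>" unfolding 1 by (subst AE_return) auto
    then show thesis using const by (subst (asm) AE_distr_iff) auto
  next
    case (2 \<mu> \<sigma>)
    have "distr M lborel Y = distr M borel Y" by (rule distr_cong) auto
    then have "distributed M lborel Y (normal_density \<mu> \<sigma>)"
      using 2 unfolding distributed_def by simp
    then show thesis using normal 2 by blast
  qed
qed

lemma (in prob_space) gaussian_square_integrable:
  assumes "gaussian_measure (distr M borel Y)" and [measurable]: "Y \<in> borel_measurable M"
  shows "integrable M (\<lambda>\<omega>. (Y \<omega>)\<^sup>2)"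
  using assms
proof (cases rule: gaussian_cases)
  case (const \<mu>)
  then have "integrable M (\<lambda>\<omega>. (Y \<omega>)\<^sup>2) \<longleftrightarrow> integrable M (\<lambda>\<omega>. \<mu>\<^sup>2)"
    by (intro integrable_cong_AE) auto
  then show ?thesis by simp
next
  case (normal \<mu> \<sigma>)
  note i = integrable_normal_moment[OF normal(1), of \<mu>]
  \<comment> \<open>The square is expanded around \<open>\<mu>\<close> to reduce it to central
    moments.\<close>
  have "integrable lborel (\<lambda>x. normal_density \<mu> \<sigma> x * (x - \<mu>)^2 +
      2 * \<mu> * (normal_density \<mu> \<sigma> x * (x - \<mu>)^1) + \<mu>\<^sup>2 * (normal_density \<mu> \<sigma> x * (x - \<mu>)^0))"
    by (intro Bochner_Integration.integrable_add integrable_mult_right i)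
  then have "integrable lborel (\<lambda>x. normal_density \<mu> \<sigma> x * x\<^sup>2)"
    by (rule back_subst[of "integrable lborel"]) (auto simp: power2_eq_square algebra_simps)
  then show ?thesis
    by (subst (asm) distributed_integrable[OF normal(2), where g = "\<lambda>x. x\<^sup>2"]) auto
qed

text \<open>Mean 0 and second moment \<open>\<tau>\<^sup>2\<close> determine the Gaussian law. The
  degenerate branch is genuine: an increment vanishes for equal points, and for antipodal ones when
  the field is even.\<close>

lemma (in prob_space) centered_gaussian_cases:
  assumes "gaussian_measure (distr M borel Y)" and [measurable]: "Y \<in> borel_measurable M"
    and "expectation Y = 0" "expectation (\<lambda>\<omega>. (Y \<omega>)\<^sup>2) = \<tau>\<^sup>2" "\<tau> \<ge> 0"
  obtains (zero) "\<tau> = 0" "AE \<omega> in M. Y \<omega> = 0"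
    | (normal) "\<tau> > 0" "distributed M lborel Y (normal_density 0 \<tau>)"
  using assms(1,2)
proof (cases rule: gaussian_cases)
  case (const \<mu>)
  have "expectation Y = expectation (\<lambda>_. \<mu>)" using const by (intro integral_cong_AE) auto
  then have \<mu>: "\<mu> = 0" using assms(3) by (simp add: prob_space)
  have "expectation (\<lambda>\<omega>. (Y \<omega>)\<^sup>2) = expectation (\<lambda>_. 0)"
    using const \<mu> by (intro integral_cong_AE) auto
  then have "\<tau> = 0" using assms(4) by simp
  then show thesis using zero const \<mu> by simp
next
  case (normal \<mu> \<sigma>)
  have \<mu>: "\<mu> = 0" using normal_distributed_expectation[OF normal] assms(3) by simp
  have "\<sigma>\<^sup>2 = \<tau>\<^sup>2" using normal_distributed_variance[OF normal] assms(3,4) by simp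
  then have "\<sigma> = \<tau>" using normal(1) assms(5) by simp
  then show thesis using that(2) normal \<mu> by simp
qed

text \<open>The factor is the double factorial of 2m - 1, the moment of order 2m of the standard
  normal law. In the degenerate case both sides vanish because \<open>m > 0\<close>.\<close>

lemma (in prob_space) nn_integral_centered_gaussian_even:
  assumes "gaussian_measure (distr M borel Y)" and [measurable]: "Y \<in> borel_measurable M"
    and "expectation Y = 0" "expectation (\<lambda>\<omega>. (Y \<omega>)\<^sup>2) = \<tau>\<^sup>2" "\<tau> \<ge> 0" "m > 0"
  shows "(\<integral>\<^sup>+\<omega>. ennreal (\<bar>Y \<omega>\<bar> ^ (2 * m)) \<partial>M) = ennreal (fact (2 * m) / (2 ^ m * fact m) * \<tau> ^ (2 * m))"
  using assms(1-5)
proof (cases rule: centered_gaussian_cases)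
  case zero
  then have "(\<integral>\<^sup>+\<omega>. ennreal (\<bar>Y \<omega>\<bar> ^ (2 * m)) \<partial>M) = (\<integral>\<^sup>+\<omega>. 0 \<partial>M)"
    using assms(6) by (intro nn_integral_cong_AE) auto
  then show ?thesis using zero assms(6) by simp
next
  case normal
  have "(\<integral>\<^sup>+\<omega>. ennreal (\<bar>Y \<omega>\<bar> ^ (2 * m)) \<partial>M) =
      (\<integral>\<^sup>+x. ennreal (normal_density 0 \<tau> x) * ennreal (\<bar>x\<bar> ^ (2 * m)) \<partial>lborel)"
    by (rule distributed_nn_integral[OF normal(2), symmetric]) simp
  also have "\<dots> = (\<integral>\<^sup>+x. ennreal (normal_density 0 \<tau> x * (x - 0) ^ (2 * m)) \<partial>lborel)"
    by (intro nn_integral_cong) (simp add: ennreal_mult' power_even_abs)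
  also have "\<dots> = ennreal (fact (2 * m) / ((2 / \<tau>\<^sup>2) ^ m * fact m))"
    using normal_moment_even[OF normal(1), of 0 m]
    by (subst nn_integral_eq_integral) (auto simp: has_bochner_integral_iff)
  also have "fact (2 * m) / ((2 / \<tau>\<^sup>2) ^ m * fact m) = fact (2 * m) / (2 ^ m * fact m) * \<tau> ^ (2 * m)"
    using normal(1) by (simp add: power_divide power_mult)
  finally show ?thesis .
qed

lemma nn_integral_abs_powr_interval:
  fixes p t :: real
  assumes "0 \<le> p" "p < 1" "0 \<le> t"
  shows "(\<integral>\<^sup>+x. ennreal (\<bar>x\<bar> powr (- p)) * indicator {-t..t} x \<partial>lborel) \<le> ennreal (2 * t powr (1 - p) / (1 - p))"
proof -
  define f where "f x = ennreal (\<bar>x\<bar> powr (- p)) * indicator {0..t} x" for x :: real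
  have [measurable]: "f \<in> borel_measurable borel" unfolding f_def by measurable
  have int: "(\<integral>\<^sup>+x. f x \<partial>lborel) = ennreal (t powr (1 - p) / (1 - p))"
  proof -
    have "((\<lambda>x. x powr (- p)) has_integral (t powr (- p + 1) / (- p + 1))) {0..t}"
      using assms by (intro has_integral_powr_from_0) auto
    from nn_integral_has_integral_lebesgue'[OF _ this]
    have "(\<integral>\<^sup>+x. ennreal (x powr (- p)) * indicator {0..t} x \<partial>lborel) = ennreal (t powr (1 - p) / (1 - p))"
      by simp
    moreover have "(\<integral>\<^sup>+x. f x \<partial>lborel) = (\<integral>\<^sup>+x. ennreal (x powr (- p)) * indicator {0..t} x \<partial>lborel)"
      by (intro nn_integral_cong) (auto simp: f_def indicator_def)
    ultimately show ?thesis by simp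
  qed
  have "(\<integral>\<^sup>+x. ennreal (\<bar>x\<bar> powr (- p)) * indicator {-t..t} x \<partial>lborel) \<le> (\<integral>\<^sup>+x. f x + f (- x) \<partial>lborel)"
    by (intro nn_integral_mono) (auto simp: f_def indicator_def)
  also have "\<dots> = (\<integral>\<^sup>+x. f x \<partial>lborel) + (\<integral>\<^sup>+x. f (- x) \<partial>lborel)"
    by (intro nn_integral_add) auto
  also have "(\<integral>\<^sup>+x. f (- x) \<partial>lborel) = (\<integral>\<^sup>+x. f x \<partial>lborel)"
    using nn_integral_real_affine[of f "-1" 0] by simp
  finally show ?thesis
    using assms by (simp add: int ennreal_plus[symmetric] del: ennreal_plus)
qed

lemma normal_density_le:
  assumes "\<sigma> > 0" shows "normal_density \<mu> \<sigma> x \<le> 1 / \<sigma>"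
proof -
  have "exp (- (x - \<mu>)\<^sup>2 / (2 * \<sigma>\<^sup>2)) \<le> 1" by simp
  moreover have "\<sigma> \<le> sqrt (2 * pi * \<sigma>\<^sup>2)"
    using pi_gt3 assms by (intro real_le_rsqrt) (simp add: mult_le_cancel_right1)
  ultimately show ?thesis
    unfolding normal_density_def using assms
    by (auto intro!: frac_le order_trans[OF mult_right_le_one_le])
qed

text \<open>Split where the absolute value equals \<open>\<tau>\<close>. Inside, the density is at
  most \<open>1 / \<tau>\<close> and the singularity contributes \<open>2 / (1 - p)\<close> times
  \<open>\<tau> powr (- p)\<close>; outside, the power itself is at most
  \<open>\<tau> powr (- p)\<close> and the density has total mass 1. The singularity at 0 is what
  forces \<open>p < 1\<close>.\<close>

lemma (in prob_space) nn_integral_normal_neg_moment: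
  assumes "distributed M lborel Y (normal_density 0 \<tau>)" "\<tau> > 0" "0 \<le> p" "p < 1"
  shows "(\<integral>\<^sup>+\<omega>. ennreal (\<bar>Y \<omega>\<bar> powr (- p)) \<partial>M) \<le> ennreal ((2 / (1 - p) + 1) * \<tau> powr (- p))"
proof -
  have "(\<integral>\<^sup>+\<omega>. ennreal (\<bar>Y \<omega>\<bar> powr (- p)) \<partial>M) =
      (\<integral>\<^sup>+x. ennreal (normal_density 0 \<tau> x) * ennreal (\<bar>x\<bar> powr (- p)) \<partial>lborel)"
    by (rule distributed_nn_integral[OF assms(1), symmetric]) simp
  also have "\<dots> \<le> (\<integral>\<^sup>+x. ennreal (1 / \<tau>) * (ennreal (\<bar>x\<bar> powr (- p)) * indicator {-\<tau>..\<tau>} x) +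
      ennreal (\<tau> powr (- p)) * ennreal (normal_density 0 \<tau> x) \<partial>lborel)"
  proof (rule nn_integral_mono)
    fix x
    show "ennreal (normal_density 0 \<tau> x) * ennreal (\<bar>x\<bar> powr (- p)) \<le>
      ennreal (1 / \<tau>) * (ennreal (\<bar>x\<bar> powr (- p)) * indicator {-\<tau>..\<tau>} x) +
      ennreal (\<tau> powr (- p)) * ennreal (normal_density 0 \<tau> x)"
    proof (cases "\<bar>x\<bar> \<le> \<tau>")
      case True
      then have "indicator {-\<tau>..\<tau>} x = (1::ennreal)" by (auto simp: indicator_def)
      then have "ennreal (normal_density 0 \<tau> x) * ennreal (\<bar>x\<bar> powr (- p)) \<le>
        ennreal (1 / \<tau>) * (ennreal (\<bar>x\<bar> powr (- p)) * indicator {-\<tau>..\<tau>} x)"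
        using normal_density_le[OF assms(2)] by (auto intro!: mult_right_mono ennreal_leI)
      then show ?thesis by (rule order_trans) simp
    next
      case False
      then have "\<bar>x\<bar> powr (- p) \<le> \<tau> powr (- p)" using assms by (intro powr_mono2') auto
      then have "ennreal (normal_density 0 \<tau> x) * ennreal (\<bar>x\<bar> powr (- p)) \<le>
        ennreal (\<tau> powr (- p)) * ennreal (normal_density 0 \<tau> x)"
        by (subst mult.commute) (auto intro!: mult_right_mono ennreal_leI)
      then show ?thesis by (rule order_trans) simp
    qed
  qed
  also have "\<dots> = ennreal (1 / \<tau>) * (\<integral>\<^sup>+x. ennreal (\<bar>x\<bar> powr (- p)) * indicator {-\<tau>..\<tau>} x \<partial>lborel) +
      ennreal (\<tau> powr (- p)) * (\<integral>\<^sup>+x. ennreal (normal_density 0 \<tau> x) \<partial>lborel)"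
    by (subst nn_integral_add) (auto simp: nn_integral_cmult)
  also have "(\<integral>\<^sup>+x. ennreal (normal_density 0 \<tau> x) \<partial>lborel) = 1"
    using assms(2) by (subst nn_integral_eq_integral) auto
  also have "ennreal (1 / \<tau>) * (\<integral>\<^sup>+x. ennreal (\<bar>x\<bar> powr (- p)) * indicator {-\<tau>..\<tau>} x \<partial>lborel) \<le>
      ennreal (1 / \<tau>) * ennreal (2 * \<tau> powr (1 - p) / (1 - p))"
    using assms by (intro mult_left_mono nn_integral_abs_powr_interval) auto
  also have "ennreal (1 / \<tau>) * ennreal (2 * \<tau> powr (1 - p) / (1 - p)) + ennreal (\<tau> powr (- p)) * 1 =
      ennreal (1 / \<tau> * (2 * \<tau> powr (1 - p) / (1 - p)) + \<tau> powr (- p))"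
    using assms by (simp add: ennreal_mult'[symmetric] ennreal_plus[symmetric] del: ennreal_plus)
  also have "1 / \<tau> * (2 * \<tau> powr (1 - p) / (1 - p)) + \<tau> powr (- p) = (2 / (1 - p) + 1) * \<tau> powr (- p)"
  proof -
    have "\<tau> powr (1 - p) = \<tau> * \<tau> powr (- p)"
      using assms(2) powr_add[of \<tau> 1 "- p"] by simp
    then show ?thesis using assms(2) by (simp add: algebra_simps)
  qed
  finally show ?thesis by (simp add: add_right_mono)
qed

section \<open>Variance and moments of the increments of the field\<close>

text \<open>With a common mean the increment is the difference of the centred variables. The last
  bound follows because the second moment of their sum is nonnegative; it holds whatever the
  correlation is, and so serves pairs of points far apart.\<close>

lemma (in prob_space) expectation_square_increment:
  assumes [measurable]: "Y \<in> borel_measurable M" "Z \<in> borel_measurable M"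
    and sq: "integrable M (\<lambda>\<omega>. (Y \<omega>)\<^sup>2)" "integrable M (\<lambda>\<omega>. (Z \<omega>)\<^sup>2)"
    and mean: "expectation Y = expectation Z"
  shows "expectation (\<lambda>\<omega>. Y \<omega> - Z \<omega>) = 0"
    and "expectation (\<lambda>\<omega>. (Y \<omega> - Z \<omega>)\<^sup>2) = variance Y + variance Z - 2 * covariance M Y Z"
    and "expectation (\<lambda>\<omega>. (Y \<omega> - Z \<omega>)\<^sup>2) \<le> 2 * variance Y + 2 * variance Z"
proof -
  have i: "integrable M Y" "integrable M Z"
    using sq by (auto intro: square_integrable_imp_integrable)
  show "expectation (\<lambda>\<omega>. Y \<omega> - Z \<omega>) = 0" using i mean by simp
  define m where "m = expectation Y"
  have YZ: "integrable M (\<lambda>\<omega>. Y \<omega> * Z \<omega>)"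
  proof (rule Bochner_Integration.integrable_bound)
    show "integrable M (\<lambda>\<omega>. (Y \<omega>)\<^sup>2 + (Z \<omega>)\<^sup>2)" using sq by simp
    have "\<bar>Y \<omega> * Z \<omega>\<bar> \<le> (Y \<omega>)\<^sup>2 + (Z \<omega>)\<^sup>2" for \<omega>
      using sum_squares_bound[of "Y \<omega>" "Z \<omega>"] sum_squares_bound[of "Y \<omega>" "- Z \<omega>"]
        zero_le_power2[of "Y \<omega>"] zero_le_power2[of "Z \<omega>"] by (auto simp: abs_if)
    then show "AE \<omega> in M. norm (Y \<omega> * Z \<omega>) \<le> norm ((Y \<omega>)\<^sup>2 + (Z \<omega>)\<^sup>2)" by auto
  qed measurable
  have *: "integrable M (\<lambda>\<omega>. (Y \<omega> - m)\<^sup>2)" "integrable M (\<lambda>\<omega>. (Z \<omega> - m)\<^sup>2)"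
    "integrable M (\<lambda>\<omega>. (Y \<omega> - m) * (Z \<omega> - m))"
    using sq i YZ by (simp_all add: power2_diff algebra_simps flip: power2_eq_square)
  have "(\<lambda>\<omega>. (Y \<omega> - Z \<omega>)\<^sup>2) = (\<lambda>\<omega>. (Y \<omega> - m)\<^sup>2 + (Z \<omega> - m)\<^sup>2 - 2 * ((Y \<omega> - m) * (Z \<omega> - m)))"
    by (auto simp: power2_eq_square algebra_simps)
  then have "expectation (\<lambda>\<omega>. (Y \<omega> - Z \<omega>)\<^sup>2) =
      expectation (\<lambda>\<omega>. (Y \<omega> - m)\<^sup>2) + expectation (\<lambda>\<omega>. (Z \<omega> - m)\<^sup>2) - 2 * expectation (\<lambda>\<omega>. (Y \<omega> - m) * (Z \<omega> - m))"
    using * by simp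
  then show eq: "expectation (\<lambda>\<omega>. (Y \<omega> - Z \<omega>)\<^sup>2) = variance Y + variance Z - 2 * covariance M Y Z"
    by (simp add: covariance_def m_def mean)
  have "0 \<le> expectation (\<lambda>\<omega>. ((Y \<omega> - m) + (Z \<omega> - m))\<^sup>2)"
    by (rule Bochner_Integration.integral_nonneg) simp
  also have "(\<lambda>\<omega>. ((Y \<omega> - m) + (Z \<omega> - m))\<^sup>2) =
      (\<lambda>\<omega>. (Y \<omega> - m)\<^sup>2 + (Z \<omega> - m)\<^sup>2 + 2 * ((Y \<omega> - m) * (Z \<omega> - m)))"
    by (auto simp: power2_eq_square algebra_simps)
  also have "expectation \<dots> = variance Y + variance Z + 2 * covariance M Y Z"
    using * by (simp add: covariance_def m_def mean)
  finally show "expectation (\<lambda>\<omega>. (Y \<omega> - Z \<omega>)\<^sup>2) \<le> 2 * variance Y + 2 * variance Z"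
    using eq by linarith
qed

lemma (in prob_space) isotropic_increment:
  assumes field: "gaussian_field M S2 X" and iso: "isotropic M X" and C: "correlation_function M X C"
  obtains \<sigma> where "\<sigma> > 0"
    and "\<And>u v. u \<in> S2 \<Longrightarrow> v \<in> S2 \<Longrightarrow> expectation (\<lambda>\<omega>. X u \<omega> - X v \<omega>) = 0"
    and "\<And>u v. u \<in> S2 \<Longrightarrow> v \<in> S2 \<Longrightarrow>
      expectation (\<lambda>\<omega>. (X u \<omega> - X v \<omega>)\<^sup>2) = 2 * \<sigma>\<^sup>2 * (C 0 - C (great_circle_dist u v))"
    and "\<And>u v. u \<in> S2 \<Longrightarrow> v \<in> S2 \<Longrightarrow> expectation (\<lambda>\<omega>. (X u \<omega> - X v \<omega>)\<^sup>2) \<le> 4 * \<sigma>\<^sup>2"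
proof -
  have X[measurable]: "X u \<in> borel_measurable M" if "u \<in> S2" for u
    using field that by (auto simp: gaussian_field_def)
  have sq: "integrable M (\<lambda>\<omega>. (X u \<omega>)\<^sup>2)" if "u \<in> S2" for u
    using gaussian_square_integrable[OF gaussian_field_variable[OF field that]] that by simp
  obtain m \<sigma> where m: "\<And>u. u \<in> S2 \<Longrightarrow> expectation (X u) = m"
    and \<sigma>: "\<sigma> > 0" "\<And>u. u \<in> S2 \<Longrightarrow> variance (X u) = \<sigma>\<^sup>2"
    using iso unfolding isotropic_def by blast
  have cov: "covariance M (X u) (X v) = \<sigma>\<^sup>2 * C (great_circle_dist u v)" if "u \<in> S2" "v \<in> S2" for u v
  proof -
    have "correlation M (X u) (X v) = C (great_circle_dist u v)"
      using C that unfolding correlation_function_def by blast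
    then show ?thesis
      using \<sigma>(1) \<sigma>(2)[OF that(1)] \<sigma>(2)[OF that(2)] unfolding correlation_def
      by (simp only: real_sqrt_abs2 abs_power2) (simp add: field_simps)
  qed
  \<comment> \<open>The correlation of a variable with itself; it lets \<open>1 - C \<theta>\<close>
    be written as the difference \<open>C 0 - C \<theta>\<close> of the fractal index.\<close>
  have C0: "C 0 = 1"
  proof -
    obtain u where u: "u \<in> S2" using sph_in_S2 by blast
    have "covariance M (X u) (X u) = variance (X u)"
      by (simp add: covariance_def power2_eq_square)
    moreover have "great_circle_dist u u = 0"
      using u by (simp add: great_circle_dist_def norm_eq_1)
    ultimately show ?thesis using cov[OF u u] \<sigma>(1) \<sigma>(2)[OF u] by simp
  qed
  show ?thesis
  proof (rule that[OF \<sigma>(1)])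
    fix u v assume uv: "u \<in> S2" "v \<in> S2"
    note * = expectation_square_increment[OF X[OF uv(1)] X[OF uv(2)] sq[OF uv(1)] sq[OF uv(2)]]
    show "expectation (\<lambda>\<omega>. X u \<omega> - X v \<omega>) = 0" using * m uv by simp
    show "expectation (\<lambda>\<omega>. (X u \<omega> - X v \<omega>)\<^sup>2) = 2 * \<sigma>\<^sup>2 * (C 0 - C (great_circle_dist u v))"
      using *(2) m \<sigma>(2) cov C0 uv by (simp add: algebra_simps)
    show "expectation (\<lambda>\<omega>. (X u \<omega> - X v \<omega>)\<^sup>2) \<le> 4 * \<sigma>\<^sup>2"
      using *(3) m \<sigma>(2) uv by simp
  qed
qed

text \<open>The lower bound holds only at short distances, since the fractal index says nothing about
  \<open>C\<close> away from \<open>0\<close>.\<close>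

lemma (in prob_space) fractal_index_increment:
  assumes field: "gaussian_field M S2 X" and iso: "isotropic M X" and frac: "has_fractal_index M X \<alpha>"
  obtains c1 c2 r :: real and \<tau> where "c1 > 0" "c2 > 0" "r > 0"
    and "\<And>u v. u \<in> S2 \<Longrightarrow> v \<in> S2 \<Longrightarrow> \<tau> u v \<ge> 0"
    and "\<And>u v. u \<in> S2 \<Longrightarrow> v \<in> S2 \<Longrightarrow> expectation (\<lambda>\<omega>. X u \<omega> - X v \<omega>) = 0"
    and "\<And>u v. u \<in> S2 \<Longrightarrow> v \<in> S2 \<Longrightarrow> expectation (\<lambda>\<omega>. (X u \<omega> - X v \<omega>)\<^sup>2) = (\<tau> u v)\<^sup>2"
    and "\<And>u v. u \<in> S2 \<Longrightarrow> v \<in> S2 \<Longrightarrow> (\<tau> u v)\<^sup>2 \<le> c2 * dist u v powr \<alpha>"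
    and "\<And>u v. u \<in> S2 \<Longrightarrow> v \<in> S2 \<Longrightarrow> dist u v < r \<Longrightarrow> c1 * dist u v powr \<alpha> \<le> (\<tau> u v)\<^sup>2"
proof -
  obtain C b where C: "correlation_function M X C" and b: "b > 0"
    and lim: "((\<lambda>\<theta>. (C 0 - C \<theta>) / \<theta> powr \<alpha>) \<longlongrightarrow> b) (at_right 0)" and \<alpha>: "\<alpha> > 0"
    using frac unfolding has_fractal_index_def by blast
  obtain \<sigma> where \<sigma>: "\<sigma> > 0"
    and mean: "\<And>u v. u \<in> S2 \<Longrightarrow> v \<in> S2 \<Longrightarrow> expectation (\<lambda>\<omega>. X u \<omega> - X v \<omega>) = 0"
    and var: "\<And>u v. u \<in> S2 \<Longrightarrow> v \<in> S2 \<Longrightarrow>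
      expectation (\<lambda>\<omega>. (X u \<omega> - X v \<omega>)\<^sup>2) = 2 * \<sigma>\<^sup>2 * (C 0 - C (great_circle_dist u v))"
    and W: "\<And>u v. u \<in> S2 \<Longrightarrow> v \<in> S2 \<Longrightarrow> expectation (\<lambda>\<omega>. (X u \<omega> - X v \<omega>)\<^sup>2) \<le> 4 * \<sigma>\<^sup>2"
    by (rule isotropic_increment[OF field iso C]) (rule that)
  define V where "V u v = expectation (\<lambda>\<omega>. (X u \<omega> - X v \<omega>)\<^sup>2)" for u v
  have V0: "V u v \<ge> 0" for u v unfolding V_def by (rule Bochner_Integration.integral_nonneg) simp
  \<comment> \<open>The limit \<open>b\<close> is positive, so \<open>b / 2\<close> and
    \<open>2 * b\<close> enclose it and keep the quotient away from 0 and infinity.\<close>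
  have "\<forall>\<^sub>F \<theta> in at_right 0. b / 2 < (C 0 - C \<theta>) / \<theta> powr \<alpha> \<and> (C 0 - C \<theta>) / \<theta> powr \<alpha> < 2 * b"
    using order_tendstoD[OF lim, of "b / 2"] order_tendstoD[OF lim, of "2 * b"] b
    by (intro eventually_conj) auto
  then obtain t where t: "t > 0" and tC: "\<And>\<theta>. 0 < \<theta> \<Longrightarrow> \<theta> < t \<Longrightarrow>
      b / 2 < (C 0 - C \<theta>) / \<theta> powr \<alpha> \<and> (C 0 - C \<theta>) / \<theta> powr \<alpha> < 2 * b"
    unfolding eventually_at_right_field by blast
  \<comment> \<open>Chords shorter than \<open>r\<close> have arcs shorter than \<open>t\<close>,
    since an arc is at most \<open>pi / 2\<close> times its chord.\<close>
  define r where "r = t * (2 / pi)"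
  have r: "r > 0" using t by (simp add: r_def)
  define c1 where "c1 = \<sigma>\<^sup>2 * b"
  define c3 where "c3 = 4 * \<sigma>\<^sup>2 * b * (pi / 2) powr \<alpha>"
  have near: "c1 * dist u v powr \<alpha> \<le> V u v \<and> V u v \<le> c3 * dist u v powr \<alpha>"
    if uv: "u \<in> S2" "v \<in> S2" and d: "dist u v < r" for u v
  proof (cases "u = v")
    case True
    then show ?thesis by (simp add: V_def)
  next
    case False
    define \<theta> where "\<theta> = great_circle_dist u v"
    have \<theta>: "dist u v \<le> \<theta>" "\<theta> \<le> pi / 2 * dist u v"
      using great_circle_dist_bounds[OF uv] by (simp_all add: \<theta>_def)
    have \<theta>0: "\<theta> > 0" using \<theta>(1) False by (metis less_le_trans zero_less_dist_iff)
    have "pi / 2 * dist u v < t" using d by (simp add: r_def field_simps)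
    then have "\<theta> < t" using \<theta>(2) by linarith
    with tC[OF \<theta>0] \<theta>0 have *: "b / 2 * \<theta> powr \<alpha> \<le> C 0 - C \<theta>" "C 0 - C \<theta> \<le> 2 * b * \<theta> powr \<alpha>"
      by (auto simp: field_simps)
    have VC: "V u v = 2 * \<sigma>\<^sup>2 * (C 0 - C \<theta>)" unfolding V_def \<theta>_def by (rule var[OF uv])
    have p: "dist u v powr \<alpha> \<le> \<theta> powr \<alpha>" "\<theta> powr \<alpha> \<le> (pi / 2 * dist u v) powr \<alpha>"
      using \<theta> \<theta>0 \<alpha> by (auto intro!: powr_mono2)
    have "c1 * dist u v powr \<alpha> \<le> c1 * \<theta> powr \<alpha>"
      using p \<sigma> b by (intro mult_left_mono) (auto simp: c1_def)
    also have "\<dots> = 2 * \<sigma>\<^sup>2 * (b / 2 * \<theta> powr \<alpha>)" by (simp add: c1_def)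
    also have "\<dots> \<le> V u v" unfolding VC using * by (intro mult_left_mono) auto
    finally have 1: "c1 * dist u v powr \<alpha> \<le> V u v" .
    have "V u v \<le> 2 * \<sigma>\<^sup>2 * (2 * b * \<theta> powr \<alpha>)" unfolding VC using * by (intro mult_left_mono) auto
    also have "\<dots> = 4 * \<sigma>\<^sup>2 * b * \<theta> powr \<alpha>" by simp
    also have "\<dots> \<le> 4 * \<sigma>\<^sup>2 * b * (pi / 2 * dist u v) powr \<alpha>"
      using p b by (intro mult_left_mono) auto
    also have "\<dots> = c3 * dist u v powr \<alpha>" unfolding c3_def by (subst powr_mult) auto
    finally show ?thesis using 1 by simp
  qed
  define W where "W = 4 * \<sigma>\<^sup>2"
  have W: "V u v \<le> W" if "u \<in> S2" "v \<in> S2" for u v using W[OF that] by (simp add: V_def W_def)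
  \<comment> \<open>From distance \<open>r\<close> on, \<open>dist u v / r\<close> is at least 1, so
    the uniform bound \<open>W\<close> is at most
    \<open>W / r powr \<alpha> * dist u v powr \<alpha>\<close>.\<close>
  define c2 where "c2 = max c3 (W / r powr \<alpha>)"
  have c3: "c3 > 0" using \<sigma> b by (simp add: c3_def)
  have far: "V u v \<le> c2 * dist u v powr \<alpha>" if uv: "u \<in> S2" "v \<in> S2" for u v
  proof (cases "dist u v < r")
    case True
    have "c3 * dist u v powr \<alpha> \<le> c2 * dist u v powr \<alpha>" by (intro mult_right_mono) (auto simp: c2_def)
    then show ?thesis using near[OF uv True] by linarith
  next
    case False
    have "0 \<le> W" using W[OF uv] V0[of u v] by linarith
    then have "V u v \<le> W / r powr \<alpha> * r powr \<alpha>" using W[OF uv] r by simp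
    also have "\<dots> \<le> W / r powr \<alpha> * dist u v powr \<alpha>"
      using False r \<alpha> \<open>0 \<le> W\<close> by (intro mult_left_mono powr_mono2) auto
    also have "\<dots> \<le> c2 * dist u v powr \<alpha>" by (intro mult_right_mono) (auto simp: c2_def)
    finally show ?thesis .
  qed
  show ?thesis
  proof (rule that[of c1 c2 r "\<lambda>u v. sqrt (V u v)"])
    show "c1 > 0" using \<sigma> b by (simp add: c1_def)
    show "c2 > 0" using c3 by (simp add: c2_def less_max_iff_disj)
    show "r > 0" by (rule r)
  qed (use V0 mean near far in \<open>auto simp flip: V_def\<close>)
qed

text \<open>The moment of order \<open>2 * m\<close> of a centred Gaussian is proportional to the
  \<open>m\<close>-th power of its variance, so the single variance bound yields the exponent
  \<open>\<alpha> * m\<close> for every \<open>m\<close>. A large \<open>m\<close> will outweigh the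
  growing number of grid points.\<close>

lemma (in prob_space) fractal_index_even_moment:
  assumes field: "gaussian_field M S2 X" and iso: "isotropic M X" and frac: "has_fractal_index M X \<alpha>"
    and m: "m > 0"
  obtains K where "K > 0" "\<And>u v. u \<in> S2 \<Longrightarrow> v \<in> S2 \<Longrightarrow>
    (\<integral>\<^sup>+\<omega>. ennreal (\<bar>X u \<omega> - X v \<omega>\<bar> ^ (2 * m)) \<partial>M) \<le> ennreal (K * dist u v powr (\<alpha> * m))"
proof -
  have X[measurable]: "X u \<in> borel_measurable M" if "u \<in> S2" for u
    using field that by (auto simp: gaussian_field_def)
  obtain c1 c2 r :: real and \<tau> where c: "c1 > 0" "c2 > 0" "r > 0"
    and \<tau>: "\<And>u v. u \<in> S2 \<Longrightarrow> v \<in> S2 \<Longrightarrow> \<tau> u v \<ge> 0"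
      "\<And>u v. u \<in> S2 \<Longrightarrow> v \<in> S2 \<Longrightarrow> expectation (\<lambda>\<omega>. X u \<omega> - X v \<omega>) = 0"
      "\<And>u v. u \<in> S2 \<Longrightarrow> v \<in> S2 \<Longrightarrow> expectation (\<lambda>\<omega>. (X u \<omega> - X v \<omega>)\<^sup>2) = (\<tau> u v)\<^sup>2"
      "\<And>u v. u \<in> S2 \<Longrightarrow> v \<in> S2 \<Longrightarrow> (\<tau> u v)\<^sup>2 \<le> c2 * dist u v powr \<alpha>"
      "\<And>u v. u \<in> S2 \<Longrightarrow> v \<in> S2 \<Longrightarrow> dist u v < r \<Longrightarrow> c1 * dist u v powr \<alpha> \<le> (\<tau> u v)\<^sup>2"
    by (rule fractal_index_increment[OF field iso frac]) (rule that)
  define f :: real where "f = fact (2 * m) / (2 ^ m * fact m)"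
  have f: "f > 0" by (simp add: f_def)
  show thesis
  proof (rule that[of "f * c2 ^ m"])
    fix u v assume uv: "u \<in> S2" "v \<in> S2"
    have "(\<integral>\<^sup>+\<omega>. ennreal (\<bar>X u \<omega> - X v \<omega>\<bar> ^ (2 * m)) \<partial>M) = ennreal (f * \<tau> u v ^ (2 * m))"
      unfolding f_def
      using uv by (intro nn_integral_centered_gaussian_even gaussian_field_increment[OF field] \<tau> m) auto
    also have "\<dots> \<le> ennreal (f * (c2 * dist u v powr \<alpha>) ^ m)"
      unfolding power_mult using f \<tau>(4)[OF uv]
      by (intro ennreal_leI mult_left_mono power_mono) auto
    also have "f * (c2 * dist u v powr \<alpha>) ^ m = f * c2 ^ m * dist u v powr (\<alpha> * m)"
      using m by (cases "u = v") (auto simp: power_mult_distrib powr_powr[symmetric] powr_realpow)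
    finally show "(\<integral>\<^sup>+\<omega>. ennreal (\<bar>X u \<omega> - X v \<omega>\<bar> ^ (2 * m)) \<partial>M) \<le> ennreal (f * c2 ^ m * dist u v powr (\<alpha> * m))" .
  qed (use f c in auto)
qed

text \<open>A negative power reverses the variance estimate, so the lower bound at distances below
  \<open>r\<close> is used; it also excludes a degenerate increment. The last conclusion accompanies
  the moment bound because \<open>0 powr (- p) = 0\<close> hides coincidences.\<close>

lemma (in prob_space) fractal_index_negative_moment:
  assumes field: "gaussian_field M S2 X" and iso: "isotropic M X" and frac: "has_fractal_index M X \<alpha>"
    and p: "0 \<le> p" "p < 1"
  obtains K r where "K > 0" "r > 0"
    "\<And>u v. u \<in> S2 \<Longrightarrow> v \<in> S2 \<Longrightarrow> u \<noteq> v \<Longrightarrow> dist u v < r \<Longrightarrow>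
      (\<integral>\<^sup>+\<omega>. ennreal (\<bar>X u \<omega> - X v \<omega>\<bar> powr (- p)) \<partial>M) \<le> ennreal (K * dist u v powr (- (\<alpha> * p / 2)))"
    "\<And>u v. u \<in> S2 \<Longrightarrow> v \<in> S2 \<Longrightarrow> u \<noteq> v \<Longrightarrow> dist u v < r \<Longrightarrow> AE \<omega> in M. X u \<omega> \<noteq> X v \<omega>"
proof -
  have X[measurable]: "X u \<in> borel_measurable M" if "u \<in> S2" for u
    using field that by (auto simp: gaussian_field_def)
  obtain c1 c2 r :: real and \<tau> where c: "c1 > 0" "c2 > 0" "r > 0"
    and \<tau>: "\<And>u v. u \<in> S2 \<Longrightarrow> v \<in> S2 \<Longrightarrow> \<tau> u v \<ge> 0"
      "\<And>u v. u \<in> S2 \<Longrightarrow> v \<in> S2 \<Longrightarrow> expectation (\<lambda>\<omega>. X u \<omega> - X v \<omega>) = 0"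
      "\<And>u v. u \<in> S2 \<Longrightarrow> v \<in> S2 \<Longrightarrow> expectation (\<lambda>\<omega>. (X u \<omega> - X v \<omega>)\<^sup>2) = (\<tau> u v)\<^sup>2"
      "\<And>u v. u \<in> S2 \<Longrightarrow> v \<in> S2 \<Longrightarrow> (\<tau> u v)\<^sup>2 \<le> c2 * dist u v powr \<alpha>"
      "\<And>u v. u \<in> S2 \<Longrightarrow> v \<in> S2 \<Longrightarrow> dist u v < r \<Longrightarrow> c1 * dist u v powr \<alpha> \<le> (\<tau> u v)\<^sup>2"
    by (rule fractal_index_increment[OF field iso frac]) (rule that)
  have normal: "\<tau> u v > 0" "distributed M lborel (\<lambda>\<omega>. X u \<omega> - X v \<omega>) (normal_density 0 (\<tau> u v))"
    if uv: "u \<in> S2" "v \<in> S2" "u \<noteq> v" "dist u v < r" for u v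
  proof -
    have "0 < c1 * dist u v powr \<alpha>" using c uv by simp
    then have "\<tau> u v \<noteq> 0" using \<tau>(5)[OF uv(1,2,4)] by auto
    moreover have "\<tau> u v = 0 \<or> \<tau> u v > 0 \<and> distributed M lborel (\<lambda>\<omega>. X u \<omega> - X v \<omega>) (normal_density 0 (\<tau> u v))"
      by (rule centered_gaussian_cases[OF gaussian_field_increment[OF field uv(1,2)]
            borel_measurable_diff[OF X[OF uv(1)] X[OF uv(2)]] \<tau>(2,3,1)[OF uv(1,2)]]) auto
    ultimately show "\<tau> u v > 0" "distributed M lborel (\<lambda>\<omega>. X u \<omega> - X v \<omega>) (normal_density 0 (\<tau> u v))"
      by auto
  qed
  define f where "f = 2 / (1 - p) + 1"
  have f: "f > 0" using p by (simp add: f_def add_pos_pos)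
  show thesis
  proof (rule that[of "f * c1 powr (- (p / 2))" r])
    fix u v assume uv: "u \<in> S2" "v \<in> S2" "u \<noteq> v" "dist u v < r"
    have "(\<integral>\<^sup>+\<omega>. ennreal (\<bar>X u \<omega> - X v \<omega>\<bar> powr (- p)) \<partial>M) \<le> ennreal (f * \<tau> u v powr (- p))"
      unfolding f_def using nn_integral_normal_neg_moment[OF normal(2,1)[OF uv] p] .
    also have "\<tau> u v powr (- p) = ((\<tau> u v)\<^sup>2) powr (- (p / 2))"
      using normal(1)[OF uv] by (simp add: powr_powr flip: powr_numeral)
    also have "ennreal (f * ((\<tau> u v)\<^sup>2) powr (- (p / 2))) \<le> ennreal (f * (c1 * dist u v powr \<alpha>) powr (- (p / 2)))"
      using f c p uv \<tau>(5)[OF uv(1,2,4)] by (intro ennreal_leI mult_left_mono powr_mono2') auto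
    also have "f * (c1 * dist u v powr \<alpha>) powr (- (p / 2)) = f * c1 powr (- (p / 2)) * dist u v powr (- (\<alpha> * p / 2))"
      using c by (simp add: powr_mult powr_powr)
    finally show "(\<integral>\<^sup>+\<omega>. ennreal (\<bar>X u \<omega> - X v \<omega>\<bar> powr (- p)) \<partial>M)
        \<le> ennreal (f * c1 powr (- (p / 2)) * dist u v powr (- (\<alpha> * p / 2)))" .
    have "AE x in lborel. x \<noteq> (0::real)" by (rule AE_lborel_singleton)
    then have "AE x in density lborel (normal_density 0 (\<tau> u v)). x \<noteq> 0"
      by (subst AE_density) auto
    then have "AE x in distr M lborel (\<lambda>\<omega>. X u \<omega> - X v \<omega>). x \<noteq> 0"
      by (simp only: distributed_distr_eq_density[OF normal(2)[OF uv]])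
    then show "AE \<omega> in M. X u \<omega> \<noteq> X v \<omega>"
      using uv X by (subst (asm) AE_distr_iff) auto
  qed (use f c in auto)
qed

section \<open>Upper bound\<close>

definition dyadic_floor :: "nat \<Rightarrow> real \<Rightarrow> real" where
  "dyadic_floor n x = of_int \<lfloor>x * 2 ^ n\<rfloor> / 2 ^ n"

definition dyadic_corner :: "nat \<Rightarrow> real \<times> real \<Rightarrow> real \<times> real" where
  "dyadic_corner n = map_prod (dyadic_floor n) (dyadic_floor n)"

lemma dyadic_floor_bounds: "dyadic_floor n x \<le> x" "x < dyadic_floor n x + 1 / 2 ^ n"
proof -
  have "of_int \<lfloor>x * 2 ^ n\<rfloor> \<le> x * 2 ^ n" "x * 2 ^ n < of_int \<lfloor>x * 2 ^ n\<rfloor> + 1"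
    by linarith+
  then show "dyadic_floor n x \<le> x" "x < dyadic_floor n x + 1 / 2 ^ n"
    by (simp_all add: dyadic_floor_def field_simps)
qed

lemma dist_dyadic_corner_le: "dist (dyadic_corner n x) x \<le> 2 / 2 ^ n"
proof (cases x)
  case (Pair a b)
  have "dist (dyadic_corner n x) x \<le> dist (dyadic_floor n a) a + dist (dyadic_floor n b) b"
    unfolding Pair dyadic_corner_def by (simp add: dist_Pair_Pair sqrt_sum_squares_le_sum)
  also have "\<dots> \<le> 1 / 2 ^ n + 1 / 2 ^ n"
    using dyadic_floor_bounds[where n = n and x = a] dyadic_floor_bounds[where n = n and x = b]
    by (intro add_mono) (auto simp: dist_real_def)
  finally show ?thesis by simp
qed

lemma dyadic_corner_tendsto: "(\<lambda>n. dyadic_corner n x) \<longlonglongrightarrow> x"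
proof (rule metric_tendsto_imp_tendsto[where f = "\<lambda>n. 2 / 2 ^ n :: real" and a = 0])
  show "(\<lambda>n. 2 / 2 ^ n :: real) \<longlonglongrightarrow> 0" by real_asymp
  show "\<forall>\<^sub>F n in sequentially. dist (dyadic_corner n x) x \<le> dist (2 / 2 ^ n) (0::real)"
    using dist_dyadic_corner_le[of _ x] by (simp add: dist_real_def)
qed

text \<open>The exponent \<open>n + 3\<close> makes the grid cover the square of side 8, which
  contains all polar angles up to \<open>pi\<close> and all azimuths below \<open>2 * pi\<close>; a
  power of two keeps the index range exact at every level.\<close>

definition dyadic_index :: "nat \<Rightarrow> (int \<times> int) set" where
  "dyadic_index n = {0..<2 ^ (n + 3)} \<times> {0..<2 ^ (n + 3)}"

definition dyadic_point :: "nat \<Rightarrow> int \<times> int \<Rightarrow> real \<times> real" where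
  "dyadic_point n = (\<lambda>(i, j). (of_int i / 2 ^ n, of_int j / 2 ^ n))"

lemma finite_dyadic_index [simp]: "finite (dyadic_index n)"
  by (simp add: dyadic_index_def)

lemma card_dyadic_index: "card (dyadic_index n) = 64 * 4 ^ n"
proof -
  have "nat (2 ^ (n + 3)) = 2 ^ (n + 3)" by (simp add: nat_power_eq)
  then show ?thesis
    using power_mult_distrib[of "2::nat" 2 n] by (simp add: dyadic_index_def power_add)
qed

lemma dyadic_corner_index:
  assumes "x \<in> {0..<8} \<times> {0..<8}"
  obtains ij where "ij \<in> dyadic_index n" "dyadic_corner n x = dyadic_point n ij"
proof -
  obtain a b where x: "x = (a, b)" "0 \<le> a" "a < 8" "0 \<le> b" "b < 8" using assms by (cases x) auto
  have fl: "0 \<le> \<lfloor>t * 2 ^ n\<rfloor> \<and> \<lfloor>t * 2 ^ n\<rfloor> < 2 ^ (n + 3)" if "0 \<le> t" "t < 8" for t :: real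
    using that by (simp add: floor_less_iff power_add)
  show ?thesis
    by (rule that[of "(\<lfloor>a * 2 ^ n\<rfloor>, \<lfloor>b * 2 ^ n\<rfloor>)"])
       (use x fl in \<open>auto simp: dyadic_index_def dyadic_point_def dyadic_corner_def dyadic_floor_def\<close>)
qed

text \<open>Telescoping from level \<open>n\<close> to level \<open>n + m\<close> gives a geometric
  sum, and continuity lets \<open>m\<close> tend to infinity because the corners of \<open>x\<close>
  converge to \<open>x\<close>.\<close>

lemma dyadic_chaining:
  fixes f :: "real \<times> real \<Rightarrow> real"
  assumes cont: "continuous_on UNIV f" and \<gamma>: "\<gamma> > 0"
    and step: "\<And>k. \<bar>f (dyadic_corner (Suc k) x) - f (dyadic_corner k x)\<bar> \<le> K * 2 powr (- \<gamma> * k)"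
  shows "\<bar>f x - f (dyadic_corner n x)\<bar> \<le> K / (1 - 2 powr (- \<gamma>)) * 2 powr (- \<gamma> * n)"
proof -
  define q where "q = 2 powr (- \<gamma>)"
  have q: "0 < q" "q < 1" using \<gamma> powr_less_mono[of "- \<gamma>" 0 2] by (auto simp: q_def)
  have qk: "2 powr (- \<gamma> * real k) = q ^ k" for k
    using powr_powr[of 2 "- \<gamma>" "real k"] powr_realpow[of "2 powr - \<gamma>" k] by (simp add: q_def)
  have K: "K \<ge> 0" using step[of 0] by simp
  have bound: "\<bar>f (dyadic_corner (n + m) x) - f (dyadic_corner n x)\<bar> \<le> K / (1 - q) * q ^ n" for m
  proof -
    \<comment> \<open>The exact partial geometric sum is carried through the induction; the final
      bound alone would not be inductive.\<close>
    have "\<bar>f (dyadic_corner (n + m) x) - f (dyadic_corner n x)\<bar> \<le> K * q ^ n * ((1 - q ^ m) / (1 - q))"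
    proof (induction m)
      case (Suc m)
      have "\<bar>f (dyadic_corner (n + Suc m) x) - f (dyadic_corner n x)\<bar> \<le>
          K * q ^ (n + m) + K * q ^ n * ((1 - q ^ m) / (1 - q))"
        using step[of "n + m"] Suc unfolding qk by simp
      also have "\<dots> = K * q ^ n * ((1 - q ^ Suc m) / (1 - q))"
        using q by (simp add: field_simps power_add)
      finally show ?case .
    qed simp
    also have "\<dots> \<le> K * q ^ n * (1 / (1 - q))"
      using q K by (intro mult_left_mono divide_right_mono) auto
    finally show ?thesis by simp
  qed
  have "(\<lambda>m. f (dyadic_corner m x)) \<longlonglongrightarrow> f x"
    using cont dyadic_corner_tendsto[of x]
    by (metis UNIV_I continuous_on_eq_continuous_at isCont_tendsto_compose open_UNIV)
  then have "(\<lambda>m. f (dyadic_corner (m + n) x)) \<longlonglongrightarrow> f x" by (rule LIMSEQ_ignore_initial_segment)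
  then have "(\<lambda>m. \<bar>f (dyadic_corner (m + n) x) - f (dyadic_corner n x)\<bar>) \<longlonglongrightarrow> \<bar>f x - f (dyadic_corner n x)\<bar>"
    by (intro tendsto_intros)
  then have "\<bar>f x - f (dyadic_corner n x)\<bar> \<le> K / (1 - q) * q ^ n"
    by (rule LIMSEQ_le_const2) (use bound in \<open>auto simp: add.commute\<close>)
  then show ?thesis unfolding qk q_def[symmetric] .
qed

lemma fine_ball_covers_finite:
  assumes "finite P" "r > 0" "2 * r \<le> \<epsilon>" "Z \<subseteq> (\<Union>p\<in>P. ball (c p) r)"
  shows "\<exists>\<B>\<in>fine_ball_covers \<epsilon> Z. (\<Sum>\<^sub>\<infinity>B\<in>\<B>. ennreal (diameter B powr \<delta>)) \<le> ennreal (card P * (2 * r) powr \<delta>)"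
proof (rule bexI)
  let ?\<B> = "(\<lambda>p. ball (c p) r) ` P"
  show "?\<B> \<in> fine_ball_covers \<epsilon> Z"
    using assms by (auto simp: fine_ball_covers_def countable_finite)
  have "(\<Sum>\<^sub>\<infinity>B\<in>?\<B>. ennreal (diameter B powr \<delta>)) = (\<Sum>B\<in>?\<B>. ennreal (diameter B powr \<delta>))"
    using assms(1) by (intro infsum_finite) simp
  also have "\<dots> = (\<Sum>B\<in>?\<B>. ennreal ((2 * r) powr \<delta>))"
    by (rule sum.cong) (use assms(2) in auto)
  also have "\<dots> = ennreal (card ?\<B> * (2 * r) powr \<delta>)"
    by (simp add: ennreal_mult' ennreal_of_nat_eq_real_of_nat)
  \<comment> \<open>Distinct indices may give the same ball, so the cardinalities satisfy only an
    inequality.\<close>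
  also have "\<dots> \<le> ennreal (card P * (2 * r) powr \<delta>)"
    using card_image_le[OF assms(1)] by (intro ennreal_leI mult_right_mono) auto
  finally show "(\<Sum>\<^sub>\<infinity>B\<in>?\<B>. ennreal (diameter B powr \<delta>)) \<le> ennreal (card P * (2 * r) powr \<delta>)" .
qed

text \<open>Above a dyadic square of side \<open>2 ^ - n\<close> the surface is covered by about
  \<open>2 ^ ((1 - \<gamma>) n)\<close> balls of radius comparable to the side.\<close>

lemma hausdorff_measure_dyadic_oscillation_eq_0:
  fixes y :: "real^3 \<Rightarrow> real"
  assumes \<gamma>: "0 < \<gamma>" "\<gamma> \<le> 1" and \<delta>: "\<delta> > 3 - \<gamma>" and K: "K \<ge> 0"
    and osc: "\<And>n x. x \<in> {0..<8} \<times> {0..<8} \<Longrightarrow>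
      \<bar>y (sph x) - y (sph (dyadic_corner n x))\<bar> \<le> K * 2 powr (- \<gamma> * n)"
  shows "hausdorff_measure \<delta> ((\<lambda>u. (u, y u)) ` S2) = 0"
proof (rule hausdorff_measure_eq_0I)
  fix \<epsilon> e :: real assume e: "\<epsilon> > 0" "e > 0"
  let ?Z = "(\<lambda>u. (u, y u)) ` S2"
  \<comment> \<open>Dividing the oscillation \<open>K * 2 powr (- \<gamma> * n)\<close> into steps
    of \<open>1 / 2 ^ n\<close> gives this many levels on each side; the extra 1 is room for
    rounding.\<close>
  define L where "L n = \<lceil>K * 2 powr ((1 - \<gamma>) * n)\<rceil> + 1" for n :: nat
  define P where "P n = dyadic_index n \<times> {- L n..L n}" for n
  \<comment> \<open>The offset is at most two sides horizontally and one vertically, three in all;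
    the fourth makes the inclusion in open balls strict.\<close>
  define r :: "nat \<Rightarrow> real" where "r n = 4 / 2 ^ n" for n
  define c where "c n = (\<lambda>(ij, k :: int). (sph (dyadic_point n ij), y (sph (dyadic_point n ij)) + of_int k / 2 ^ n))" for n
  have L0: "L n \<ge> 0" for n
  proof -
    have "0 \<le> K * 2 powr ((1 - \<gamma>) * n)" using K by simp
    then show ?thesis unfolding L_def by linarith
  qed
  have cover: "?Z \<subseteq> (\<Union>p\<in>P n. ball (c n p) (r n))" for n
  proof
    fix z assume "z \<in> ?Z"
    then obtain u where u: "u \<in> S2" "z = (u, y u)" by blast
    obtain a b where ab: "0 \<le> a" "a \<le> pi" "0 \<le> b" "b < 2 * pi" "u = sph (a, b)"
      using sph_surj[OF u(1)] .
    define x where "x = (a, b)"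
    have x: "x \<in> {0..<8} \<times> {0..<8}" using ab pi_less_4 by (auto simp: x_def)
    obtain ij where ij: "ij \<in> dyadic_index n" "dyadic_corner n x = dyadic_point n ij"
      using dyadic_corner_index[OF x] .
    define h where "h = y u - y (sph (dyadic_point n ij))"
    define k where "k = \<lfloor>h * 2 ^ n\<rfloor>"
    have "\<bar>h\<bar> \<le> K * 2 powr (- \<gamma> * n)" using osc[OF x, of n] unfolding h_def ij(2)[symmetric] by (simp add: ab(5) x_def)
    then have "\<bar>h * 2 ^ n\<bar> \<le> K * 2 powr (- \<gamma> * n) * 2 ^ n"
      by (simp add: abs_mult mult_right_mono)
    also have "\<dots> = K * 2 powr ((1 - \<gamma>) * n)"
      by (simp add: powr_realpow[symmetric] powr_add[symmetric] algebra_simps)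
    finally have "k \<in> {- L n..L n}" unfolding k_def L_def by simp linarith
    then have kP: "(ij, k) \<in> P n" using ij by (simp add: P_def)
    have k: "of_int k / 2 ^ n \<le> h" "h < of_int k / 2 ^ n + 1 / 2 ^ n"
      using dyadic_floor_bounds[where n = n and x = h] by (simp_all add: k_def dyadic_floor_def)
    have "dist (c n (ij, k)) z \<le> dist (sph (dyadic_point n ij)) u + dist (y (sph (dyadic_point n ij)) + of_int k / 2 ^ n) (y u)"
      unfolding c_def u by (simp add: dist_Pair_Pair sqrt_sum_squares_le_sum)
    also have "dist (sph (dyadic_point n ij)) u \<le> 2 / 2 ^ n"
      using sph_dist_le[of "dyadic_point n ij" x] dist_dyadic_corner_le[of n x] unfolding ij(2)[symmetric] by (simp add: ab(5) x_def)
    also have "dist (y (sph (dyadic_point n ij)) + of_int k / 2 ^ n) (y u) \<le> 1 / 2 ^ n"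
      using k by (simp add: dist_real_def h_def)
    also have "2 / 2 ^ n + 1 / 2 ^ n < r n" by (simp add: r_def field_simps)
    finally show "z \<in> (\<Union>p\<in>P n. ball (c n p) (r n))" using kP by auto
  qed
  have card: "real (card (P n)) * (2 * r n) powr \<delta> \<le>
      64 * (2 * K + 5) * 8 powr \<delta> * 2 powr ((3 - \<gamma> - \<delta>) * n)" for n
  proof -
    \<comment> \<open>Here \<open>\<gamma> \<le> 1\<close> enters: \<open>L n\<close> exceeds its
      real argument by at most 2, so \<open>2 * L n + 1\<close> has an additive constant 5, which
      this bound absorbs into the power of 2.\<close>
    have one: "1 \<le> 2 powr ((1 - \<gamma>) * n)" using \<gamma> by (intro ge_one_powr_ge_zero) auto
    have "real (card {- L n..L n}) = 2 * of_int (L n) + 1"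
      using L0[of n] by simp
    also have "\<dots> \<le> 2 * (K * 2 powr ((1 - \<gamma>) * n)) + 5" unfolding L_def by simp linarith
    also have "\<dots> \<le> (2 * K + 5) * 2 powr ((1 - \<gamma>) * n)" using one by (simp add: algebra_simps)
    finally have "real (card {- L n..L n}) \<le> (2 * K + 5) * 2 powr ((1 - \<gamma>) * n)" .
    then have "real (card (P n)) \<le> 64 * 4 ^ n * ((2 * K + 5) * 2 powr ((1 - \<gamma>) * n))"
      unfolding P_def card_cartesian_product card_dyadic_index by (simp add: mult_left_mono)
    then have "real (card (P n)) * (2 * r n) powr \<delta> \<le>
        64 * 4 ^ n * ((2 * K + 5) * 2 powr ((1 - \<gamma>) * n)) * (2 * r n) powr \<delta>"
      by (rule mult_right_mono) simp
    also have pow_r: "(2 * r n) powr \<delta> = 8 powr \<delta> * 2 powr (- \<delta> * n)"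
      by (simp add: r_def powr_divide powr_realpow[symmetric] powr_powr powr_minus divide_simps mult.commute)
    also have "(4::real) ^ n = 2 powr (2 * n)"
      by (simp add: powr_powr[symmetric] powr_realpow)
    also have "64 * 2 powr (2 * n) * ((2 * K + 5) * 2 powr ((1 - \<gamma>) * n)) * (8 powr \<delta> * 2 powr (- \<delta> * n)) =
        64 * (2 * K + 5) * 8 powr \<delta> * (2 powr (2 * n) * 2 powr ((1 - \<gamma>) * n) * 2 powr (- \<delta> * n))"
      by (simp add: ac_simps)
    also have "2 powr (2 * n) * 2 powr ((1 - \<gamma>) * n) * 2 powr (- \<delta> * n) = 2 powr ((3 - \<gamma> - \<delta>) * n)"
      by (simp add: powr_add[symmetric] algebra_simps)
    finally show ?thesis unfolding pow_r .
  qed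
  have "\<forall>\<^sub>F n in sequentially. 64 * (2 * K + 5) * 8 powr \<delta> * 2 powr ((3 - \<gamma> - \<delta>) * n) < e"
  proof (rule order_tendstoD)
    have "2 powr (3 - \<gamma> - \<delta>) < 1" using \<delta> powr_less_mono[of "3 - \<gamma> - \<delta>" 0 2] by simp
    then have "(\<lambda>n::nat. (2 powr (3 - \<gamma> - \<delta>)) ^ n) \<longlonglongrightarrow> 0" by (intro LIMSEQ_realpow_zero) auto
    then have "(\<lambda>n::nat. 2 powr ((3 - \<gamma> - \<delta>) * n)) \<longlonglongrightarrow> 0"
      by (simp add: powr_powr[symmetric] powr_realpow)
    then show "(\<lambda>n::nat. 64 * (2 * K + 5) * 8 powr \<delta> * 2 powr ((3 - \<gamma> - \<delta>) * n)) \<longlonglongrightarrow> 0"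
      by (rule tendsto_mult_right_zero)
  qed (use e in auto)
  moreover have "\<forall>\<^sub>F n in sequentially. 2 * r n < \<epsilon>"
  proof (rule order_tendstoD)
    show "(\<lambda>n::nat. 2 * r n) \<longlonglongrightarrow> 0" unfolding r_def by real_asymp
  qed (use e in auto)
  ultimately have "\<forall>\<^sub>F n in sequentially. 64 * (2 * K + 5) * 8 powr \<delta> * 2 powr ((3 - \<gamma> - \<delta>) * n) < e \<and> 2 * r n < \<epsilon>"
    by (rule eventually_conj)
  then obtain n :: nat where n: "64 * (2 * K + 5) * 8 powr \<delta> * 2 powr ((3 - \<gamma> - \<delta>) * n) < e" "2 * r n < \<epsilon>"
    using eventually_happens'[OF sequentially_bot] by blast
  have fin: "finite (P n)" by (simp add: P_def)
  have r0: "r n > 0" by (simp add: r_def)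
  obtain \<B> where \<B>: "\<B> \<in> fine_ball_covers \<epsilon> ?Z"
    "(\<Sum>\<^sub>\<infinity>B\<in>\<B>. ennreal (diameter B powr \<delta>)) \<le> ennreal (card (P n) * (2 * r n) powr \<delta>)"
    using fine_ball_covers_finite[OF fin r0 less_imp_le[OF n(2)] cover] by blast
  have "ennreal (card (P n) * (2 * r n) powr \<delta>) \<le> ennreal e"
    using card[of n] n(1) by (intro ennreal_leI) simp
  with \<B> show "\<exists>\<B>\<in>fine_ball_covers \<epsilon> ?Z. (\<Sum>\<^sub>\<infinity>B\<in>\<B>. ennreal (diameter B powr \<delta>)) \<le> ennreal e"
    using order_trans by blast
qed

section \<open>Increments along the edges between consecutive grid levels\<close>

definition dyadic_parent :: "int \<times> int \<Rightarrow> int \<times> int" where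
  "dyadic_parent = map_prod (\<lambda>i. i div 2) (\<lambda>i. i div 2)"

text \<open>Halving an index and rounding down gives the floor at the coarser scale. Hence the
  successive corners of a point are joined by child-to-parent edges, and controlling the finitely
  many edges of each level controls all points at once.\<close>

lemma dyadic_corner_parent:
  assumes "x \<in> {0..<8} \<times> {0..<8}"
  obtains ij where "ij \<in> dyadic_index (Suc k)" "dyadic_corner (Suc k) x = dyadic_point (Suc k) ij"
    "dyadic_corner k x = dyadic_point k (dyadic_parent ij)"
proof -
  obtain a b where x: "x = (a, b)" "0 \<le> a" "a < 8" "0 \<le> b" "b < 8" using assms by (cases x) auto
  have fl: "0 \<le> \<lfloor>t * 2 ^ Suc k\<rfloor> \<and> \<lfloor>t * 2 ^ Suc k\<rfloor> < 2 ^ (Suc k + 3)" if "0 \<le> t" "t < 8" for t :: real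
    using that by (simp add: floor_less_iff power_add)
  have half: "\<lfloor>t * 2 ^ Suc k\<rfloor> div 2 = \<lfloor>t * 2 ^ k\<rfloor>" for t :: real
    using floor_divide_of_int_eq floor_divide_real_eq_div[of 2 "t * 2 ^ Suc k"] by simp
  show ?thesis
  proof (rule that[of "(\<lfloor>a * 2 ^ Suc k\<rfloor>, \<lfloor>b * 2 ^ Suc k\<rfloor>)"])
    show "(\<lfloor>a * 2 ^ Suc k\<rfloor>, \<lfloor>b * 2 ^ Suc k\<rfloor>) \<in> dyadic_index (Suc k)"
      unfolding dyadic_index_def using fl x by auto
    show "dyadic_corner (Suc k) x = dyadic_point (Suc k) (\<lfloor>a * 2 ^ Suc k\<rfloor>, \<lfloor>b * 2 ^ Suc k\<rfloor>)"
      unfolding dyadic_corner_def dyadic_floor_def dyadic_point_def x by simp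
    show "dyadic_corner k x = dyadic_point k (dyadic_parent (\<lfloor>a * 2 ^ Suc k\<rfloor>, \<lfloor>b * 2 ^ Suc k\<rfloor>))"
      unfolding dyadic_corner_def dyadic_floor_def dyadic_point_def dyadic_parent_def x map_prod_simp half by simp
  qed
qed

lemma dist_dyadic_parent_le: "dist (dyadic_point (Suc k) ij) (dyadic_point k (dyadic_parent ij)) \<le> 1 / 2 ^ k"
proof -
  obtain i j where ij: "ij = (i, j)" by (cases ij)
  have *: "dist (of_int n / 2 ^ Suc k) (of_int (n div 2) / 2 ^ k :: real) \<le> 1 / 2 ^ Suc k" for n :: int
  proof -
    have "of_int n / 2 ^ Suc k - of_int (n div 2) / 2 ^ k = (of_int (n mod 2) / 2 ^ Suc k :: real)"
    proof -
      have "2 * real_of_int (n div 2) + of_int (n mod 2) = of_int n"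
        using arg_cong[OF mult_div_mod_eq[of 2 n], of real_of_int] unfolding of_int_add of_int_mult by simp
      then show ?thesis by (simp add: field_simps)
    qed
    moreover have "0 \<le> n mod 2" "n mod 2 \<le> 1" by simp_all
    then have "0 \<le> real_of_int (n mod 2)" "real_of_int (n mod 2) \<le> 1" by linarith+
    ultimately show ?thesis by (simp add: dist_real_def divide_right_mono)
  qed
  have "dist (dyadic_point (Suc k) ij) (dyadic_point k (dyadic_parent ij)) \<le>
      dist (of_int i / 2 ^ Suc k) (of_int (i div 2) / 2 ^ k :: real) + dist (of_int j / 2 ^ Suc k) (of_int (j div 2) / 2 ^ k :: real)"
    unfolding ij dyadic_point_def dyadic_parent_def map_prod_simp case_prod_conv dist_Pair_Pair
    by (rule sqrt_sum_squares_le_sum) auto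
  also have "\<dots> \<le> 1 / 2 ^ Suc k + 1 / 2 ^ Suc k" by (intro add_mono *)
  finally show ?thesis by simp
qed

text \<open>Kolmogorov--Chentsov: with \<open>2m\<close> moments, the weighted sum over all levels of the increments
  between neighbouring grid points has finite expectation as soon as \<open>m (\<alpha> - 2\<gamma>) > 2\<close>.\<close>

lemma (in prob_space) AE_dyadic_increments:
  assumes field: "gaussian_field M S2 X" and iso: "isotropic M X" and frac: "has_fractal_index M X \<alpha>"
    and \<gamma>: "\<gamma> < \<alpha> / 2"
  shows "AE \<omega> in M. \<exists>K\<ge>0. \<forall>k. \<forall>ij\<in>dyadic_index (Suc k).
    \<bar>X (sph (dyadic_point (Suc k) ij)) \<omega> - X (sph (dyadic_point k (dyadic_parent ij))) \<omega>\<bar> \<le> K * 2 powr (- \<gamma> * k)"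
proof -
  \<comment> \<open>The order is chosen after \<open>\<gamma>\<close>: the smaller the gap
    \<open>\<alpha> - 2 * \<gamma>\<close>, the higher the moment.\<close>
  obtain m :: nat where m: "m * (\<alpha> - 2 * \<gamma>) > 2"
    using \<gamma> reals_Archimedean3[of "\<alpha> - 2 * \<gamma>"] by auto
  have m0: "m > 0" using m by (cases m) auto
  have \<alpha>: "\<alpha> > 0" using frac by (simp add: has_fractal_index_def)
  obtain K where K: "K > 0" and mom: "\<And>u v. u \<in> S2 \<Longrightarrow> v \<in> S2 \<Longrightarrow>
    (\<integral>\<^sup>+\<omega>. ennreal (\<bar>X u \<omega> - X v \<omega>\<bar> ^ (2 * m)) \<partial>M) \<le> ennreal (K * dist u v powr (\<alpha> * m))"
    by (rule fractal_index_even_moment[OF field iso frac m0]) (rule that)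
  define D where "D k ij \<omega> = \<bar>X (sph (dyadic_point (Suc k) ij)) \<omega> - X (sph (dyadic_point k (dyadic_parent ij))) \<omega>\<bar>"
    for k ij \<omega>
  have X[measurable]: "X (sph p) \<in> borel_measurable M" for p
    using field sph_in_S2 by (auto simp: gaussian_field_def)
  have D[measurable]: "D k ij \<in> borel_measurable M" for k ij unfolding D_def by measurable
  define w where "w k = 2 powr (\<gamma> * k)" for k :: nat
  define S where "S \<omega> = (\<Sum>k. \<Sum>ij\<in>dyadic_index (Suc k). ennreal ((D k ij \<omega> * w k) ^ (2 * m)))" for \<omega>
  have S[measurable]: "S \<in> borel_measurable M" unfolding S_def by measurable
  \<comment> \<open>Ratio of the level sums: each level has four times as many grid points, while
    one weighted moment shrinks by
    \<open>2 powr (- (m * (\<alpha> - 2 * \<gamma>)))\<close>.\<close>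
  define q where "q = 4 * 2 powr (- (m * (\<alpha> - 2 * \<gamma>)))"
  have q: "0 < q" "q < 1"
  proof -
    have "q < 4 * 2 powr (- 2)" unfolding q_def using m by (intro mult_strict_left_mono powr_less_mono) auto
    also have "4 * 2 powr (- 2) = (1::real)" by (simp add: powr_minus)
    finally show "q < 1" .
  qed (simp add: q_def)
  have increment: "(\<integral>\<^sup>+\<omega>. ennreal ((D k ij \<omega> * w k) ^ (2 * m)) \<partial>M) \<le> ennreal (K * (q / 4) ^ k)" for k ij
  proof -
    have w: "w k ^ (2 * m) = 2 powr (2 * m * \<gamma> * k)"
      unfolding w_def powr_realpow[symmetric, of "2 powr _", simplified] powr_powr by (simp add: ac_simps)
    have "(\<integral>\<^sup>+\<omega>. ennreal ((D k ij \<omega> * w k) ^ (2 * m)) \<partial>M) =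
        (\<integral>\<^sup>+\<omega>. ennreal (w k ^ (2 * m)) * ennreal (D k ij \<omega> ^ (2 * m)) \<partial>M)"
      by (intro nn_integral_cong) (simp add: power_mult_distrib ennreal_mult'' w_def mult.commute)
    also have "\<dots> = ennreal (w k ^ (2 * m)) * (\<integral>\<^sup>+\<omega>. ennreal (D k ij \<omega> ^ (2 * m)) \<partial>M)"
      by (rule nn_integral_cmult) measurable
    also have "\<dots> \<le> ennreal (w k ^ (2 * m)) * ennreal (K * dist (sph (dyadic_point (Suc k) ij)) (sph (dyadic_point k (dyadic_parent ij))) powr (\<alpha> * m))"
      unfolding D_def by (intro mult_left_mono mom sph_in_S2) simp
    also have "\<dots> \<le> ennreal (w k ^ (2 * m)) * ennreal (K * (1 / 2 ^ k) powr (\<alpha> * m))"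
      using K \<alpha> order_trans[OF sph_dist_le dist_dyadic_parent_le]
      by (intro mult_left_mono ennreal_leI powr_mono2) auto
    also have "\<dots> = ennreal (w k ^ (2 * m) * (K * (1 / 2 ^ k) powr (\<alpha> * m)))"
      using K by (simp add: ennreal_mult w_def)
    also have "w k ^ (2 * m) * (K * (1 / 2 ^ k) powr (\<alpha> * m)) = K * (q / 4) ^ k"
    proof -
      have "(1 / 2 ^ k) powr (\<alpha> * m) = 2 powr (- (\<alpha> * m * k))"
        by (simp add: powr_divide powr_realpow[symmetric] powr_powr powr_minus divide_simps ac_simps)
      moreover have "(q / 4) ^ k = 2 powr (- (m * (\<alpha> - 2 * \<gamma>)) * k)"
        by (simp add: q_def powr_power mult.commute)
      ultimately show ?thesis
        unfolding w by (simp add: powr_add[symmetric] algebra_simps)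
    qed
    finally show ?thesis .
  qed
  \<comment> \<open>The constant 256 is 64 times 4, because the edges of step \<open>k\<close> are
    indexed by the points of level \<open>Suc k\<close>.\<close>
  have level: "(\<integral>\<^sup>+\<omega>. (\<Sum>ij\<in>dyadic_index (Suc k). ennreal ((D k ij \<omega> * w k) ^ (2 * m))) \<partial>M) \<le> ennreal (256 * K * q ^ k)" for k
  proof -
    have "(\<integral>\<^sup>+\<omega>. (\<Sum>ij\<in>dyadic_index (Suc k). ennreal ((D k ij \<omega> * w k) ^ (2 * m))) \<partial>M) =
        (\<Sum>ij\<in>dyadic_index (Suc k). \<integral>\<^sup>+\<omega>. ennreal ((D k ij \<omega> * w k) ^ (2 * m)) \<partial>M)"
      by (rule nn_integral_sum) measurable
    also have "\<dots> \<le> (\<Sum>ij\<in>dyadic_index (Suc k). ennreal (K * (q / 4) ^ k))" by (intro sum_mono increment)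
    also have "\<dots> = ennreal (real (64 * 4 ^ Suc k) * (K * (q / 4) ^ k))"
      by (simp add: card_dyadic_index ennreal_mult' ennreal_of_nat_eq_real_of_nat)
    also have "real (64 * 4 ^ Suc k) * (K * (q / 4) ^ k) = 256 * K * q ^ k"
      by (simp add: power_divide)
    finally show ?thesis .
  qed
  have "(\<integral>\<^sup>+\<omega>. S \<omega> \<partial>M) = (\<Sum>k. \<integral>\<^sup>+\<omega>. (\<Sum>ij\<in>dyadic_index (Suc k). ennreal ((D k ij \<omega> * w k) ^ (2 * m))) \<partial>M)"
    unfolding S_def by (rule nn_integral_suminf) measurable
  also have "\<dots> \<le> (\<Sum>k. ennreal (256 * K * q ^ k))" by (intro suminf_le level) auto
  also have "\<dots> = ennreal (\<Sum>k. 256 * K * q ^ k)"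
    using q K by (intro suminf_ennreal2 summable_mult summable_geometric) auto
  finally have "(\<integral>\<^sup>+\<omega>. S \<omega> \<partial>M) < \<infinity>" by (rule order_le_less_trans) simp
  then have "AE \<omega> in M. S \<omega> \<noteq> \<infinity>" by (intro nn_integral_PInf_AE) auto
  then show ?thesis
  proof (rule AE_mp, intro AE_I2 impI)
    fix \<omega> assume "S \<omega> \<noteq> \<infinity>"
    then obtain R where R: "S \<omega> = ennreal R" "R \<ge> 0" by (cases "S \<omega>") auto
    have "D k ij \<omega> \<le> (1 + R) * 2 powr (- \<gamma> * k)" if ij: "ij \<in> dyadic_index (Suc k)" for k ij
    proof -
      let ?d = "D k ij \<omega> * w k"
      have d0: "?d \<ge> 0" by (simp add: D_def w_def)
      have "ennreal (?d ^ (2 * m)) \<le> (\<Sum>ij\<in>dyadic_index (Suc k). ennreal ((D k ij \<omega> * w k) ^ (2 * m)))"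
        using ij by (intro sum_nonneg_leq_bound[OF _ _ refl] member_le_sum) auto
      also have "\<dots> = (\<Sum>l\<in>{k}. \<Sum>ij\<in>dyadic_index (Suc l). ennreal ((D l ij \<omega> * w l) ^ (2 * m)))" by simp
      also have "\<dots> \<le> S \<omega>" unfolding S_def by (intro sum_le_suminf) auto
      finally have le: "?d ^ (2 * m) \<le> R" using R by simp
      \<comment> \<open>The bound \<open>1 + R\<close> avoids a root of order \<open>2 * m\<close>:
        a number above it is at least 1, hence at most its own power, hence at most
        \<open>R\<close>, which is absurd.\<close>
      have "?d \<le> 1 + R"
      proof (rule ccontr)
        assume "\<not> ?d \<le> 1 + R"
        then have "?d \<ge> 1" "?d > R" using R by auto
        then have "?d \<le> ?d ^ (2 * m)" using m0 by (intro self_le_power) auto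
        then show False using le \<open>?d > R\<close> by simp
      qed
      then show ?thesis by (simp add: w_def powr_minus field_simps)
    qed
    then show "\<exists>K\<ge>0. \<forall>k. \<forall>ij\<in>dyadic_index (Suc k).
      \<bar>X (sph (dyadic_point (Suc k) ij)) \<omega> - X (sph (dyadic_point k (dyadic_parent ij))) \<omega>\<bar> \<le> K * 2 powr (- \<gamma> * k)"
      using R by (intro exI[of _ "1 + R"]) (auto simp: D_def)
  qed
qed

text \<open>Cutting off at \<open>c\<close> does not increase differences, so the increments of the
  field bound those of the truncated surface. The random constant does not depend on
  \<open>\<delta>\<close>, hence one null set serves all \<open>\<delta>\<close>.\<close>

lemma (in prob_space) AE_hausdorff_measure_truncated_surface_eq_0:
  assumes field: "gaussian_field M S2 X" and iso: "isotropic M X" and frac: "has_fractal_index M X \<alpha>"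
    and cont: "AE \<omega> in M. continuous_on S2 (\<lambda>u. X u \<omega>)"
    and \<gamma>: "0 < \<gamma>" "\<gamma> \<le> 1" "\<gamma> < \<alpha> / 2"
  shows "AE \<omega> in M. \<forall>\<delta>. \<delta> > 3 - \<gamma> \<longrightarrow> hausdorff_measure \<delta> (truncated_surface c (\<lambda>u. X u \<omega>)) = 0"
proof -
  from cont AE_dyadic_increments[OF field iso frac \<gamma>(3)] show ?thesis
  proof eventually_elim
    case (elim \<omega>)
    then obtain K where K: "K \<ge> 0" and inc: "\<And>k ij. ij \<in> dyadic_index (Suc k) \<Longrightarrow>
      \<bar>X (sph (dyadic_point (Suc k) ij)) \<omega> - X (sph (dyadic_point k (dyadic_parent ij))) \<omega>\<bar> \<le> K * 2 powr (- \<gamma> * k)"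
      by blast
    define y where "y u = max c (X u \<omega>)" for u
    have cy: "continuous_on UNIV (\<lambda>p. y (sph p))"
      using sph_continuous_comp[OF elim(1)] unfolding y_def by (intro continuous_intros)
    define K' where "K' = K / (1 - 2 powr (- \<gamma>))"
    have "2 powr (- \<gamma>) < 1" using \<gamma>(1) powr_less_mono[of "- \<gamma>" 0 2] by simp
    then have K': "K' \<ge> 0" using K by (simp add: K'_def)
    have "\<bar>y (sph x) - y (sph (dyadic_corner n x))\<bar> \<le> K' * 2 powr (- \<gamma> * n)"
      if x: "x \<in> {0..<8} \<times> {0..<8}" for n x
      unfolding K'_def
    proof (rule dyadic_chaining[OF cy \<gamma>(1)])
      fix k
      obtain ij where ij: "ij \<in> dyadic_index (Suc k)" "dyadic_corner (Suc k) x = dyadic_point (Suc k) ij"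
        "dyadic_corner k x = dyadic_point k (dyadic_parent ij)"
        using dyadic_corner_parent[OF x] .
      have "\<bar>y (sph (dyadic_corner (Suc k) x)) - y (sph (dyadic_corner k x))\<bar> \<le>
          \<bar>X (sph (dyadic_corner (Suc k) x)) \<omega> - X (sph (dyadic_corner k x)) \<omega>\<bar>"
        unfolding y_def by (auto simp: max_def)
      also have "\<dots> \<le> K * 2 powr (- \<gamma> * k)" using inc[OF ij(1)] by (simp add: ij)
      finally show "\<bar>y (sph (dyadic_corner (Suc k) x)) - y (sph (dyadic_corner k x))\<bar> \<le> K * 2 powr (- \<gamma> * k)" .
    qed
    from hausdorff_measure_dyadic_oscillation_eq_0[OF \<gamma>(1,2) _ K' this]
    show ?case by (simp add: truncated_surface_def y_def)
  qed
qed

section \<open>Lower bound\<close>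

text \<open>On a closed interval strictly between 0 and \<open>pi\<close> the sine has a positive
  minimum, which provides a lower Lipschitz constant for the chart. Sides at most 1 keep coordinate
  differences within the range of Jordan's inequality.\<close>

lemma sph_dist_ge_on_rectangle:
  assumes "0 < p1" "p1 \<le> q1" "q1 < pi" "q1 - p1 \<le> 1" "q2 - p2 \<le> 1"
  obtains \<kappa> where "\<kappa> > 0" "\<And>x y. x \<in> {p1..q1} \<times> {p2..q2} \<Longrightarrow> y \<in> {p1..q1} \<times> {p2..q2} \<Longrightarrow>
    \<kappa> * \<bar>fst x - fst y\<bar> \<le> dist (sph x) (sph y) \<and> \<kappa> * \<bar>snd x - snd y\<bar> \<le> dist (sph x) (sph y)"
proof -
  have "\<exists>a0\<in>{p1..q1}. \<forall>a\<in>{p1..q1}. sin a0 \<le> sin a"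
    using assms by (intro continuous_attains_inf) (auto intro!: continuous_intros)
  then obtain a0 where a0: "a0 \<in> {p1..q1}" "\<And>a. a \<in> {p1..q1} \<Longrightarrow> sin a0 \<le> sin a" by blast
  have pos: "sin a0 > 0" using a0(1) assms by (intro sin_gt_zero) auto
  show ?thesis
  proof (rule that[of "sin a0 / pi"])
    fix x y assume xy: "x \<in> {p1..q1} \<times> {p2..q2}" "y \<in> {p1..q1} \<times> {p2..q2}"
    obtain a b a' b' where *: "x = (a, b)" "y = (a', b')" by (cases x, cases y)
    have "sin a0 * max \<bar>a - a'\<bar> \<bar>b - b'\<bar> \<le> pi * dist (sph (a, b)) (sph (a', b'))"
      using xy assms a0 pos pi_gt3 unfolding * by (intro sph_dist_ge) auto
    moreover have "sin a0 * \<bar>a - a'\<bar> \<le> sin a0 * max \<bar>a - a'\<bar> \<bar>b - b'\<bar>"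
      "sin a0 * \<bar>b - b'\<bar> \<le> sin a0 * max \<bar>a - a'\<bar> \<bar>b - b'\<bar>"
      using pos by (intro mult_left_mono; simp)+
    ultimately show "sin a0 / pi * \<bar>fst x - fst y\<bar> \<le> dist (sph x) (sph y) \<and> sin a0 / pi * \<bar>snd x - snd y\<bar> \<le> dist (sph x) (sph y)"
      unfolding * by (simp add: field_simps)
  qed (use pos in auto)
qed

lemma emeasure_lborel_rectangle:
  fixes a b c d :: real
  assumes "a \<le> b" "c \<le> d"
  shows "emeasure lborel ({a..b} \<times> {c..d}) = ennreal ((b - a) * (d - c))"
proof -
  have "emeasure lborel ({a..b} \<times> {c..d}) = emeasure (lborel \<Otimes>\<^sub>M lborel) ({a..b} \<times> {c..d})"
    by (simp add: lborel_prod)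
  also have "\<dots> = ennreal (b - a) * ennreal (d - c)"
    using assms by (subst lborel.emeasure_pair_measure_Times) auto
  finally show ?thesis using assms by (simp add: ennreal_mult)
qed

lemma rectangle_sets [measurable]: "{a..b} \<times> {c..d} \<in> sets (borel :: (real \<times> real) measure)"
  by (intro borel_closed closed_Times) auto

text \<open>Lebesgue measure on a coordinate square clear of the poles serves as mass: a ball of
  radius \<open>r\<close> pulls back into a square of side \<open>2 * r / \<kappa>\<close>, which
  explains the order 2 and the constant \<open>4 / \<kappa>\<^sup>2\<close>.\<close>

lemma hausdorff_measure_flat_graph_eq_top:
  assumes "\<delta> < 2" shows "hausdorff_measure \<delta> (S2 \<times> {c::real}) = \<infinity>"
proof -
  define Q :: "(real \<times> real) set" where "Q = {1..2} \<times> {0..1}"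
  have Q[measurable]: "Q \<in> sets borel" unfolding Q_def by measurable
  obtain \<kappa> where \<kappa>: "\<kappa> > 0" and bi: "\<And>x y. x \<in> Q \<Longrightarrow> y \<in> Q \<Longrightarrow>
    \<kappa> * \<bar>fst x - fst y\<bar> \<le> dist (sph x) (sph y) \<and> \<kappa> * \<bar>snd x - snd y\<bar> \<le> dist (sph x) (sph y)"
    using sph_dist_ge_on_rectangle[of 1 2 1 0] pi_gt3 unfolding Q_def by auto
  define G where "G x = (sph x, c)" for x
  define \<mu> where "\<mu> = restrict_space lborel Q"
  have sp: "space \<mu> = Q" by (simp add: \<mu>_def space_restrict_space)
  have [measurable]: "sph \<in> borel_measurable borel"
    by (intro borel_measurable_continuous_onI continuous_intros)
  show ?thesis
  proof (rule hausdorff_measure_eq_top_of_mass_distribution[where G = G and \<mu> = \<mu> and A = Q and N = "4 / \<kappa>\<^sup>2" and s = 2])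
    show "G \<in> borel_measurable \<mu>"
      unfolding \<mu>_def G_def by (intro measurable_restrict_space1) measurable
    show "Q \<in> sets \<mu>" unfolding \<mu>_def by (simp add: sets_restrict_space_iff)
    show "emeasure \<mu> Q > 0"
      unfolding \<mu>_def by (simp add: emeasure_restrict_space) (simp add: Q_def emeasure_lborel_rectangle)
    show "G ` space \<mu> \<subseteq> S2 \<times> {c}" unfolding G_def using sph_in_S2 by blast
    fix x r assume x: "x \<in> Q" and r: "(r::real) > 0"
    have "emeasure \<mu> {y \<in> space \<mu>. dist (G x) (G y) \<le> r} = emeasure lborel {y \<in> space \<mu>. dist (G x) (G y) \<le> r}"
      unfolding \<mu>_def by (subst emeasure_restrict_space) (auto simp: space_restrict_space)
    also have "\<dots> \<le> emeasure lborel ({fst x - r / \<kappa>..fst x + r / \<kappa>} \<times> {snd x - r / \<kappa>..snd x + r / \<kappa>})"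
    proof (rule emeasure_mono)
      show "{y \<in> space \<mu>. dist (G x) (G y) \<le> r} \<subseteq> {fst x - r / \<kappa>..fst x + r / \<kappa>} \<times> {snd x - r / \<kappa>..snd x + r / \<kappa>}"
      proof
        fix y assume "y \<in> {y \<in> space \<mu>. dist (G x) (G y) \<le> r}"
        then have y: "y \<in> Q" "dist (sph x) (sph y) \<le> r" by (auto simp: sp G_def dist_Pair_Pair)
        then have "\<kappa> * \<bar>fst x - fst y\<bar> \<le> r" "\<kappa> * \<bar>snd x - snd y\<bar> \<le> r" using bi[OF x y(1)] by auto
        then have "\<bar>fst x - fst y\<bar> \<le> r / \<kappa>" "\<bar>snd x - snd y\<bar> \<le> r / \<kappa>"
          using \<kappa> by (simp_all add: field_simps)
        then show "y \<in> {fst x - r / \<kappa>..fst x + r / \<kappa>} \<times> {snd x - r / \<kappa>..snd x + r / \<kappa>}"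
          by (cases y) auto
      qed
    qed measurable
    also have "\<dots> = ennreal (4 / \<kappa>\<^sup>2 * r powr 2)"
      using r \<kappa> by (subst emeasure_lborel_rectangle) (auto simp: power2_eq_square field_simps)
    finally show "emeasure \<mu> {y \<in> space \<mu>. dist (G x) (G y) \<le> r} \<le> ennreal (4 / \<kappa>\<^sup>2 * r powr 2)" .
  qed (use assms in auto)
qed

lemma nn_integral_shifted_powr_le:
  fixes x p q \<eta> :: real
  assumes "0 \<le> \<eta>" "\<eta> < 1" "x \<in> {p..q}" "q - p \<le> 1"
  shows "(\<integral>\<^sup>+y. ennreal (\<bar>x - y\<bar> powr (- \<eta>)) * indicator {p..q} y \<partial>lborel) \<le> ennreal (2 / (1 - \<eta>))"
proof -
  have "(\<integral>\<^sup>+y. ennreal (\<bar>x - y\<bar> powr (- \<eta>)) * indicator {p..q} y \<partial>lborel) \<le>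
      (\<integral>\<^sup>+y. ennreal (\<bar>y - x\<bar> powr (- \<eta>)) * indicator {-1..1} (y - x) \<partial>lborel)"
    using assms by (intro nn_integral_mono) (auto simp: indicator_def abs_minus_commute)
  also have "\<dots> = (\<integral>\<^sup>+t. ennreal (\<bar>t\<bar> powr (- \<eta>)) * indicator {-1..1} t \<partial>lborel)"
    using nn_integral_real_affine[of "\<lambda>t. ennreal (\<bar>t - x\<bar> powr (- \<eta>)) * indicator {-1..1} (t - x)" 1 x]
    by simp
  also have "\<dots> \<le> ennreal (2 / (1 - \<eta>))"
    using nn_integral_abs_powr_interval[of \<eta> 1] assms by simp
  finally show ?thesis .
qed

text \<open>For \<open>\<beta> < 2\<close> the chordal kernel is integrable in two dimensions: bounding the distance below
  by either coordinate splits the singularity into two one-dimensional ones of order \<open>\<beta> / 2 < 1\<close>.\<close>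

lemma nn_integral_sph_dist_powr_le:
  assumes \<beta>: "0 \<le> \<beta>" "\<beta> < 2" and \<kappa>: "\<kappa> > 0" and side: "q1 - p1 \<le> 1" "q2 - p2 \<le> 1"
    and bi: "\<And>x y. x \<in> {p1..q1} \<times> {p2..q2} \<Longrightarrow> y \<in> {p1..q1} \<times> {p2..q2} \<Longrightarrow>
      \<kappa> * \<bar>fst x - fst y\<bar> \<le> dist (sph x) (sph y) \<and> \<kappa> * \<bar>snd x - snd y\<bar> \<le> dist (sph x) (sph y)"
    and x: "x \<in> {p1..q1} \<times> {p2..q2}"
  shows "(\<integral>\<^sup>+y. ennreal (dist (sph x) (sph y) powr (- \<beta>)) * indicator ({p1..q1} \<times> {p2..q2}) y \<partial>lborel)
    \<le> ennreal (\<kappa> powr (- \<beta>) * (2 / (1 - \<beta> / 2))\<^sup>2)"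
proof -
  let ?Q = "{p1..q1} \<times> {p2..q2}"
  define J where "J = 2 / (1 - \<beta> / 2)"
  have J: "J \<ge> 0" using \<beta> by (simp add: J_def)
  obtain a b where ab: "x = (a, b)" "a \<in> {p1..q1}" "b \<in> {p2..q2}" using x by (cases x) auto
  have [measurable]: "sph \<in> borel_measurable borel"
    by (intro borel_measurable_continuous_onI continuous_intros)
  define F where "F y = ennreal (dist (sph x) (sph y) powr (- \<beta>)) * indicator ?Q y" for y
  have F[measurable]: "F \<in> borel_measurable (lborel \<Otimes>\<^sub>M lborel)"
  proof -
    have "(\<lambda>y. ennreal (dist (sph x) (sph y) powr (- \<beta>))) \<in> borel_measurable borel" by measurable
    then have "F \<in> borel_measurable borel"
      unfolding F_def by (intro borel_measurable_times_ennreal borel_measurable_indicator rectangle_sets)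
    then show ?thesis by (simp add: lborel_prod)
  qed
  define g where "g a' = ennreal (\<bar>a - a'\<bar> powr (- (\<beta> / 2))) * indicator {p1..q1} a'" for a' :: real
  define h where "h b' = ennreal (\<bar>b - b'\<bar> powr (- (\<beta> / 2))) * indicator {p2..q2} b'" for b' :: real
  have [measurable]: "g \<in> borel_measurable borel" "h \<in> borel_measurable borel"
    unfolding g_def h_def by measurable
  \<comment> \<open>The lines \<open>a' = a\<close> and \<open>b' = b\<close> are left out: there a
    factor \<open>0 powr e\<close> is 0 and the bound may fail. Both are null sets.\<close>
  have le: "F (a', b') \<le> ennreal (\<kappa> powr (- \<beta>)) * g a' * h b'" if "a' \<noteq> a" "b' \<noteq> b" for a' b'
  proof (cases "(a', b') \<in> ?Q")
    case True
    let ?d = "dist (sph x) (sph (a', b'))"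
    have d: "\<kappa> * \<bar>a - a'\<bar> \<le> ?d" "\<kappa> * \<bar>b - b'\<bar> \<le> ?d" using bi[OF x True] by (simp_all add: ab)
    define e where "e = - (\<beta> / 2)"
    have e2: "t powr (- \<beta>) = t powr e * t powr e" for t :: real
      using powr_add[of t e e] by (simp add: e_def)
    have "?d powr e * ?d powr e \<le> (\<kappa> * \<bar>a - a'\<bar>) powr e * (\<kappa> * \<bar>b - b'\<bar>) powr e"
      using d \<beta> \<kappa> that unfolding e_def by (intro mult_mono powr_mono2') auto
    also have "\<dots> = (\<kappa> powr e * \<kappa> powr e) * \<bar>a - a'\<bar> powr e * \<bar>b - b'\<bar> powr e"
      using \<kappa> by (simp add: powr_mult)
    finally have "?d powr (- \<beta>) \<le> \<kappa> powr (- \<beta>) * \<bar>a - a'\<bar> powr e * \<bar>b - b'\<bar> powr e"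
      unfolding e2 .
    then have "ennreal (?d powr (- \<beta>)) \<le> ennreal (\<kappa> powr (- \<beta>)) * ennreal (\<bar>a - a'\<bar> powr e) * ennreal (\<bar>b - b'\<bar> powr e)"
      by (simp only: ennreal_mult'[symmetric] powr_ge_zero mult_nonneg_nonneg ennreal_leI)
    then show ?thesis
      using True by (simp add: F_def g_def h_def e_def)
  qed (simp add: F_def)
  have "(\<integral>\<^sup>+y. F y \<partial>lborel) = (\<integral>\<^sup>+a'. \<integral>\<^sup>+b'. F (a', b') \<partial>lborel \<partial>lborel)"
    using lborel.nn_integral_fst[OF F] by (simp add: lborel_prod)
  also have "\<dots> \<le> (\<integral>\<^sup>+a'. \<integral>\<^sup>+b'. ennreal (\<kappa> powr (- \<beta>)) * g a' * h b' \<partial>lborel \<partial>lborel)"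
  proof (rule nn_integral_mono_AE)
    show "AE a' in lborel. (\<integral>\<^sup>+b'. F (a', b') \<partial>lborel) \<le> (\<integral>\<^sup>+b'. ennreal (\<kappa> powr (- \<beta>)) * g a' * h b' \<partial>lborel)"
      using AE_lborel_singleton[of a]
    proof eventually_elim
      case (elim a')
      show ?case
      proof (rule nn_integral_mono_AE)
        show "AE b' in lborel. F (a', b') \<le> ennreal (\<kappa> powr (- \<beta>)) * g a' * h b'"
          using AE_lborel_singleton[of b] by eventually_elim (rule le[OF elim])
      qed
    qed
  qed
  also have "\<dots> = ennreal (\<kappa> powr (- \<beta>)) * (\<integral>\<^sup>+a'. g a' \<partial>lborel) * (\<integral>\<^sup>+b'. h b' \<partial>lborel)"
    by (simp add: nn_integral_cmult nn_integral_multc)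
  also have "\<dots> \<le> ennreal (\<kappa> powr (- \<beta>)) * ennreal J * ennreal J"
    unfolding g_def h_def J_def using \<beta> ab side
    by (intro mult_mono nn_integral_shifted_powr_le) auto
  also have "\<dots> = ennreal (\<kappa> powr (- \<beta>) * J\<^sup>2)"
    using J by (simp add: ennreal_mult'[symmetric] power2_eq_square mult.assoc)
  finally show ?thesis by (simp add: F_def J_def)
qed

section \<open>A jointly measurable version of the field and the energy of its graph\<close>

text \<open>Built from grid values only, so that the energy can be integrated over
  \<open>\<omega>\<close> and the coordinates together. Where the limit fails to exist the value is
  arbitrary; on a continuous path the field is recovered.\<close>

definition path_limit :: "(real^3 \<Rightarrow> 'w \<Rightarrow> real) \<Rightarrow> 'w \<Rightarrow> real \<times> real \<Rightarrow> real" where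
  "path_limit X \<omega> x = lim (\<lambda>n. X (sph (dyadic_corner n x)) \<omega>)"

lemma path_limit_eq:
  assumes "continuous_on S2 (\<lambda>u. X u \<omega>)"
  shows "path_limit X \<omega> x = X (sph x) \<omega>"
proof -
  have "isCont (\<lambda>p. X (sph p) \<omega>) x"
    using sph_continuous_comp[OF assms] unfolding continuous_on_eq_continuous_at[OF open_UNIV] by blast
  then have "(\<lambda>n. X (sph (dyadic_corner n x)) \<omega>) \<longlonglongrightarrow> X (sph x) \<omega>"
    by (rule isCont_tendsto_compose[OF _ dyadic_corner_tendsto])
  then show ?thesis unfolding path_limit_def by (rule limI)
qed

lemma dyadic_corner_eq_point: "dyadic_corner n x = dyadic_point n (\<lfloor>fst x * 2 ^ n\<rfloor>, \<lfloor>snd x * 2 ^ n\<rfloor>)"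
  by (cases x) (simp add: dyadic_corner_def dyadic_floor_def dyadic_point_def)

text \<open>The field itself need not be jointly measurable, but this version of it is, since each
  dyadic approximation takes only countably many field values.\<close>

lemma path_limit_measurable:
  assumes "\<And>u. u \<in> S2 \<Longrightarrow> X u \<in> borel_measurable M"
  shows "(\<lambda>(\<omega>, x). path_limit X \<omega> x) \<in> borel_measurable (M \<Otimes>\<^sub>M borel)"
proof -
  have X: "X (sph p) \<in> borel_measurable M" for p using assms sph_in_S2 by blast
  have "(\<lambda>z. X (sph (dyadic_corner n (snd z))) (fst z)) \<in> borel_measurable (M \<Otimes>\<^sub>M borel)" for n
  proof -
    have coord: "(\<lambda>x::real \<times> real. fst x * 2 ^ n) \<in> borel_measurable borel"
      "(\<lambda>x::real \<times> real. snd x * 2 ^ n) \<in> borel_measurable borel"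
      by (intro borel_measurable_continuous_onI continuous_intros)+
    define k1 k2 :: "real \<times> real \<Rightarrow> int" where "k1 x = \<lfloor>fst x * 2 ^ n\<rfloor>" and "k2 x = \<lfloor>snd x * 2 ^ n\<rfloor>" for x
    have "k1 \<in> borel \<rightarrow>\<^sub>M count_space UNIV" "k2 \<in> borel \<rightarrow>\<^sub>M count_space UNIV"
      unfolding k1_def k2_def
      by (rule measurable_compose[OF coord(1) measurable_real_floor],
          rule measurable_compose[OF coord(2) measurable_real_floor])
    then have k: "(\<lambda>z. k1 (snd z)) \<in> (M \<Otimes>\<^sub>M borel) \<rightarrow>\<^sub>M count_space UNIV"
      "(\<lambda>z. k2 (snd z)) \<in> (M \<Otimes>\<^sub>M borel) \<rightarrow>\<^sub>M count_space UNIV"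
      by (auto intro: measurable_compose[OF measurable_snd])
    have "(\<lambda>z. X (sph (dyadic_point n (i, j))) (fst z)) \<in> borel_measurable (M \<Otimes>\<^sub>M borel)" for i j
      by (rule measurable_compose[OF measurable_fst X])
    \<comment> \<open>The two integer indices are substituted one at a time, each through a
      countable family of measurable functions.\<close>
    then have "(\<lambda>z. X (sph (dyadic_point n (i, k2 (snd z)))) (fst z)) \<in> borel_measurable (M \<Otimes>\<^sub>M borel)" for i
      using k(2) by (rule measurable_compose_countable[where f = "\<lambda>j z. X (sph (dyadic_point n (i, j))) (fst z)"])
    then have "(\<lambda>z. X (sph (dyadic_point n (k1 (snd z), k2 (snd z)))) (fst z)) \<in> borel_measurable (M \<Otimes>\<^sub>M borel)"
      using k(1) by (rule measurable_compose_countable[where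
            f = "\<lambda>i z. X (sph (dyadic_point n (i, k2 (snd z)))) (fst z)"])
    then show ?thesis unfolding dyadic_corner_eq_point k1_def k2_def .
  qed
  then show ?thesis
    unfolding path_limit_def case_prod_beta by (rule borel_measurable_lim_metric)
qed

text \<open>Each component distance is at most the distance in the product, so under a negative
  exponent either may replace it. Dividing the exponent as \<open>(s - p) + p\<close> leaves only
  \<open>p\<close>, later taken below 1, on the random component.\<close>

lemma powr_dist_graph_le:
  assumes "0 \<le> p" "p \<le> s" "fst a \<noteq> fst b" "snd a \<noteq> (snd b :: real)"
  shows "dist a b powr (- s) \<le> dist (fst a) (fst b) powr (- (s - p)) * \<bar>snd a - snd b\<bar> powr (- p)"
proof -
  have "dist a b powr (- s) = dist a b powr (- (s - p)) * dist a b powr (- p)"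
    by (simp add: powr_add[symmetric])
  also have "\<dots> \<le> dist (fst a) (fst b) powr (- (s - p)) * \<bar>snd a - snd b\<bar> powr (- p)"
    using assms dist_fst_le[of a b] dist_snd_le[of a b]
    by (intro mult_mono powr_mono2') (auto simp: dist_real_def)
  finally show ?thesis .
qed

text \<open>Tonelli's theorem moves the expectation of the energy inside the double integral, where
  it is bounded by the deterministic kernel of order \<open>\<beta> < 2\<close>. The conclusion
  covers every \<open>Z\<close> containing the graph, so it applies directly to the truncated
  surface.\<close>

lemma (in prob_space) AE_hausdorff_measure_graph_rectangle_eq_top:
  assumes field: "gaussian_field M S2 X" and iso: "isotropic M X" and frac: "has_fractal_index M X \<alpha>"
    and \<alpha>: "\<alpha> \<le> 2" and cont: "AE \<omega> in M. continuous_on S2 (\<lambda>u. X u \<omega>)"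
    and s: "1 < s" "s < 3 - \<alpha> / 2"
  obtains r where "r > 0" "\<And>p1 q1 p2 q2. \<lbrakk>0 < p1; p1 < q1; q1 < pi; p2 < q2; q1 - p1 < r; q2 - p2 < r\<rbrakk> \<Longrightarrow>
    AE \<omega> in M. \<forall>\<delta> Z. \<delta> < s \<longrightarrow> (\<lambda>x. (sph x, X (sph x) \<omega>)) ` ({p1..q1} \<times> {p2..q2}) \<subseteq> Z \<longrightarrow>
      hausdorff_measure \<delta> Z = \<infinity>"
proof -
  have \<alpha>0: "\<alpha> > 0" using frac by (simp add: has_fractal_index_def)
  \<comment> \<open>The requirement reads \<open>s - 2 < p * w\<close> with
    \<open>w = 1 - \<alpha> / 2\<close>, and \<open>s < 3 - \<alpha> / 2\<close> says
    \<open>s - 2 < w\<close>, so some \<open>p < 1\<close> meets it. For \<open>\<alpha> = 2\<close>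
    the weight \<open>w\<close> is 0, \<open>s < 2\<close> holds outright, and any \<open>p\<close>
    will do.\<close>
  obtain p where p: "0 < p" "p < 1" "s - p + \<alpha> * p / 2 < 2"
  proof (cases "\<alpha> = 2")
    case True
    then show ?thesis using that[of "1 / 2"] s by simp
  next
    case False
    define w where "w = 1 - \<alpha> / 2"
    have w: "w > 0" "s - 2 < w" using False \<alpha> s by (simp_all add: w_def)
    then have "max 0 ((s - 2) / w) < 1" by (simp add: divide_less_eq)
    then obtain p where p: "max 0 ((s - 2) / w) < p" "p < 1" using dense by blast
    then have "s - 2 < p * w" using w by (simp add: divide_less_eq)
    then have "s - p + \<alpha> * p / 2 < 2" by (simp add: w_def field_simps)
    then show ?thesis using that[of p] p by simp
  qed
  define \<beta> where "\<beta> = s - p + \<alpha> * p / 2"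
  have \<beta>: "0 \<le> \<beta>" "\<beta> < 2" using p s \<alpha>0 by (auto simp: \<beta>_def intro!: add_nonneg_nonneg)
  obtain K r where K: "K > 0" and r: "r > 0" and
    mom: "\<And>u v. u \<in> S2 \<Longrightarrow> v \<in> S2 \<Longrightarrow> u \<noteq> v \<Longrightarrow> dist u v < r \<Longrightarrow>
      (\<integral>\<^sup>+\<omega>. ennreal (\<bar>X u \<omega> - X v \<omega>\<bar> powr (- p)) \<partial>M) \<le> ennreal (K * dist u v powr (- (\<alpha> * p / 2)))" and
    ne: "\<And>u v. u \<in> S2 \<Longrightarrow> v \<in> S2 \<Longrightarrow> u \<noteq> v \<Longrightarrow> dist u v < r \<Longrightarrow> AE \<omega> in M. X u \<omega> \<noteq> X v \<omega>"
    by (rule fractal_index_negative_moment[OF field iso frac less_imp_le[OF p(1)] p(2)]) (rule that)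
  have X: "\<And>u. u \<in> S2 \<Longrightarrow> X u \<in> borel_measurable M"
    using field by (auto simp: gaussian_field_def)
  have [measurable]: "X (sph x) \<in> borel_measurable M" for x using X sph_in_S2 by blast
  have sphm[measurable]: "sph \<in> borel_measurable borel"
    by (intro borel_measurable_continuous_onI continuous_intros)
  define Y where "Y = path_limit X"
  have Ym: "(\<lambda>z. Y (fst z) (snd z)) \<in> borel_measurable (M \<Otimes>\<^sub>M borel)"
    using path_limit_measurable[OF X] by (simp add: Y_def case_prod_beta')
  have YX: "AE \<omega> in M. \<forall>x. Y \<omega> x = X (sph x) \<omega>"
    using cont by eventually_elim (simp add: Y_def path_limit_eq)
  define d where "d \<omega> x y = dist (sph x, Y \<omega> x) (sph y, Y \<omega> y)" for \<omega> x y
  have pair_mean: "(\<integral>\<^sup>+\<omega>. ennreal (d \<omega> x y powr (- s)) \<partial>M) \<le> ennreal (K * dist (sph x) (sph y) powr (- \<beta>))"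
    if xy: "sph x \<noteq> sph y" "dist (sph x) (sph y) < r" for x y
  proof -
    let ?h = "dist (sph x) (sph y)"
    have "(\<integral>\<^sup>+\<omega>. ennreal (d \<omega> x y powr (- s)) \<partial>M) \<le>
        (\<integral>\<^sup>+\<omega>. ennreal (?h powr (- (s - p))) * ennreal (\<bar>X (sph x) \<omega> - X (sph y) \<omega>\<bar> powr (- p)) \<partial>M)"
    proof (rule nn_integral_mono_AE)
      show "AE \<omega> in M. ennreal (d \<omega> x y powr (- s)) \<le>
          ennreal (?h powr (- (s - p))) * ennreal (\<bar>X (sph x) \<omega> - X (sph y) \<omega>\<bar> powr (- p))"
        using YX ne[OF sph_in_S2 sph_in_S2 xy]
      proof eventually_elim
        case (elim \<omega>)
        have eq: "Y \<omega> x = X (sph x) \<omega>" "Y \<omega> y = X (sph y) \<omega>" using elim(1) by blast+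
        have "d \<omega> x y powr (- s) \<le> ?h powr (- (s - p)) * \<bar>X (sph x) \<omega> - X (sph y) \<omega>\<bar> powr (- p)"
          using powr_dist_graph_le[of p s "(sph x, Y \<omega> x)" "(sph y, Y \<omega> y)"] p s xy elim(2)
          by (simp add: d_def eq)
        then show ?case by (simp add: ennreal_mult'[symmetric] ennreal_leI)
      qed
    qed
    also have "\<dots> = ennreal (?h powr (- (s - p))) * (\<integral>\<^sup>+\<omega>. ennreal (\<bar>X (sph x) \<omega> - X (sph y) \<omega>\<bar> powr (- p)) \<partial>M)"
      by (rule nn_integral_cmult) measurable
    also have "\<dots> \<le> ennreal (?h powr (- (s - p))) * ennreal (K * ?h powr (- (\<alpha> * p / 2)))"
      by (intro mult_left_mono mom[OF sph_in_S2 sph_in_S2 xy]) simp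
    also have "\<dots> = ennreal (?h powr (- (s - p)) * (K * ?h powr (- (\<alpha> * p / 2))))"
      by (simp add: ennreal_mult')
    also have "?h powr (- (s - p)) * (K * ?h powr (- (\<alpha> * p / 2))) = K * (?h powr (- (s - p)) * ?h powr (- (\<alpha> * p / 2)))"
      by simp
    also have "?h powr (- (s - p)) * ?h powr (- (\<alpha> * p / 2)) = ?h powr (- \<beta>)"
      unfolding powr_add[symmetric] \<beta>_def by (simp add: algebra_simps)
    finally show ?thesis .
  qed
  show thesis
  proof (rule that[of "min (r / 2) 1"])
    \<comment> \<open>Two sides below \<open>r / 2\<close> keep all chords of the rectangle below
      \<open>r\<close>; sides below 1 are what the chart estimate requires.\<close>
    show "min (r / 2) 1 > 0" using r by simp
    fix p1 q1 p2 q2 :: real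
    assume Q0: "0 < p1" "p1 < q1" "q1 < pi" "p2 < q2" "q1 - p1 < min (r / 2) 1" "q2 - p2 < min (r / 2) 1"
    define Q where "Q = {p1..q1} \<times> {p2..q2}"
    have Q[measurable]: "Q \<in> sets borel" unfolding Q_def by (rule rectangle_sets)
    obtain \<kappa> where \<kappa>: "\<kappa> > 0" and bi: "\<And>x y. x \<in> {p1..q1} \<times> {p2..q2} \<Longrightarrow> y \<in> {p1..q1} \<times> {p2..q2} \<Longrightarrow>
      \<kappa> * \<bar>fst x - fst y\<bar> \<le> dist (sph x) (sph y) \<and> \<kappa> * \<bar>snd x - snd y\<bar> \<le> dist (sph x) (sph y)"
      using sph_dist_ge_on_rectangle[of p1 q1 q2 p2] Q0 by auto
    have inj: "x = y" if "x \<in> Q" "y \<in> Q" "sph x = sph y" for x y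
      using bi[of x y] that \<kappa> by (auto simp: Q_def mult_le_0_iff prod_eq_iff)
    have near: "dist (sph x) (sph y) < r" if "x \<in> Q" "y \<in> Q" for x y
    proof -
      have "dist x y \<le> \<bar>fst x - fst y\<bar> + \<bar>snd x - snd y\<bar>"
        by (cases x, cases y) (simp add: dist_Pair_Pair dist_real_def sqrt_sum_squares_le_sum_abs)
      moreover have "\<bar>fst x - fst y\<bar> \<le> q1 - p1" "\<bar>snd x - snd y\<bar> \<le> q2 - p2"
        using that by (auto simp: Q_def)
      ultimately have "dist x y < r" using Q0 by linarith
      then show ?thesis using sph_dist_le[of x y] by linarith
    qed
    define J where "J = \<kappa> powr (- \<beta>) * (2 / (1 - \<beta> / 2))\<^sup>2"
    have J0: "J \<ge> 0" by (simp add: J_def)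
    have J: "(\<integral>\<^sup>+y. ennreal (dist (sph x) (sph y) powr (- \<beta>)) * indicator Q y \<partial>lborel) \<le> ennreal J" if "x \<in> Q" for x
      using nn_integral_sph_dist_powr_le[OF \<beta> \<kappa> _ _ bi] that Q0 unfolding J_def Q_def by simp
    define \<mu> where "\<mu> = restrict_space (lborel :: (real \<times> real) measure) Q"
    have sp: "space \<mu> = Q" by (simp add: \<mu>_def space_restrict_space)
    have Qmass: "emeasure lborel Q = ennreal ((q1 - p1) * (q2 - p2))"
      unfolding Q_def using Q0 by (intro emeasure_lborel_rectangle) auto
    have em: "emeasure \<mu> (space \<mu>) = ennreal ((q1 - p1) * (q2 - p2))"
      unfolding sp by (simp add: \<mu>_def emeasure_restrict_space Qmass)
    interpret \<mu>: finite_measure \<mu> by standard (simp add: em)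
    have id\<mu>: "(\<lambda>x. x) \<in> \<mu> \<rightarrow>\<^sub>M borel" unfolding \<mu>_def by (rule measurable_restrict_space1) simp
    have Y\<mu>: "(\<lambda>z. Y (fst z) (g z)) \<in> borel_measurable N"
      if f: "fst \<in> N \<rightarrow>\<^sub>M M" and g: "g \<in> N \<rightarrow>\<^sub>M borel" for N :: "('a \<times> 'c) measure" and g
      using measurable_compose[OF measurable_Pair[OF f g] Ym] by simp
    have e3: "(\<lambda>z. ennreal (d (fst z) (fst (snd z)) (snd (snd z)) powr (- s))) \<in> borel_measurable (M \<Otimes>\<^sub>M (\<mu> \<Otimes>\<^sub>M \<mu>))"
    proof -
      have c1: "(\<lambda>z. fst (snd z)) \<in> M \<Otimes>\<^sub>M (\<mu> \<Otimes>\<^sub>M \<mu>) \<rightarrow>\<^sub>M borel" and c2: "(\<lambda>z. snd (snd z)) \<in> M \<Otimes>\<^sub>M (\<mu> \<Otimes>\<^sub>M \<mu>) \<rightarrow>\<^sub>M borel"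
        by (rule measurable_compose[OF measurable_compose[OF measurable_snd measurable_fst] id\<mu>],
            rule measurable_compose[OF measurable_compose[OF measurable_snd measurable_snd] id\<mu>])
      note [measurable] = Y\<mu>[OF measurable_fst c1] Y\<mu>[OF measurable_fst c2]
        measurable_compose[OF c1 sphm] measurable_compose[OF c2 sphm]
      show ?thesis unfolding d_def by measurable
    qed
    have total: "(\<integral>\<^sup>+\<omega>. (\<integral>\<^sup>+z. ennreal (d \<omega> (fst z) (snd z) powr (- s)) \<partial>(\<mu> \<Otimes>\<^sub>M \<mu>)) \<partial>M) < \<infinity>"
    proof -
      interpret \<mu>\<mu>: pair_sigma_finite \<mu> \<mu> ..
      interpret M\<mu>\<mu>: pair_sigma_finite M "\<mu> \<Otimes>\<^sub>M \<mu>" ..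
      have hm: "(\<lambda>z. ennreal (dist (sph (fst z)) (sph (snd z)) powr (- \<beta>))) \<in> borel_measurable (\<mu> \<Otimes>\<^sub>M \<mu>)"
      proof -
        note [measurable] = measurable_compose[OF measurable_compose[OF measurable_fst id\<mu>] sphm]
          measurable_compose[OF measurable_compose[OF measurable_snd id\<mu>] sphm]
        show ?thesis by measurable
      qed
      have "(\<integral>\<^sup>+\<omega>. (\<integral>\<^sup>+z. ennreal (d \<omega> (fst z) (snd z) powr (- s)) \<partial>(\<mu> \<Otimes>\<^sub>M \<mu>)) \<partial>M) =
          (\<integral>\<^sup>+z. (\<integral>\<^sup>+\<omega>. ennreal (d \<omega> (fst z) (snd z) powr (- s)) \<partial>M) \<partial>(\<mu> \<Otimes>\<^sub>M \<mu>))"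
        using e3 by (intro M\<mu>\<mu>.Fubini'[symmetric]) (simp add: case_prod_beta')
      also have "\<dots> \<le> (\<integral>\<^sup>+z. ennreal K * ennreal (dist (sph (fst z)) (sph (snd z)) powr (- \<beta>)) \<partial>(\<mu> \<Otimes>\<^sub>M \<mu>))"
      proof (rule nn_integral_mono)
        fix z assume "z \<in> space (\<mu> \<Otimes>\<^sub>M \<mu>)"
        then have z: "fst z \<in> Q" "snd z \<in> Q" by (auto simp: space_pair_measure sp)
        show "(\<integral>\<^sup>+\<omega>. ennreal (d \<omega> (fst z) (snd z) powr (- s)) \<partial>M) \<le>
            ennreal K * ennreal (dist (sph (fst z)) (sph (snd z)) powr (- \<beta>))"
        proof (cases "sph (fst z) = sph (snd z)")
          \<comment> \<open>On the diagonal \<open>d\<close> is 0, and so is its negative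
            power.\<close>
          case True
          then have "fst z = snd z" using inj z by blast
          then show ?thesis by (simp add: d_def)
        next
          case False
          then show ?thesis using pair_mean[OF False near[OF z]] K by (simp add: ennreal_mult')
        qed
      qed
      also have "\<dots> = ennreal K * (\<integral>\<^sup>+z. ennreal (dist (sph (fst z)) (sph (snd z)) powr (- \<beta>)) \<partial>(\<mu> \<Otimes>\<^sub>M \<mu>))"
        by (rule nn_integral_cmult[OF hm])
      also have "(\<integral>\<^sup>+z. ennreal (dist (sph (fst z)) (sph (snd z)) powr (- \<beta>)) \<partial>(\<mu> \<Otimes>\<^sub>M \<mu>)) =
          (\<integral>\<^sup>+x. \<integral>\<^sup>+y. ennreal (dist (sph x) (sph y) powr (- \<beta>)) \<partial>\<mu> \<partial>\<mu>)"
        using \<mu>.nn_integral_fst[OF hm] by simp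
      also have "\<dots> \<le> (\<integral>\<^sup>+x. ennreal J \<partial>\<mu>)"
      proof (rule nn_integral_mono)
        fix x assume "x \<in> space \<mu>"
        then have "x \<in> Q" by (simp add: sp)
        then show "(\<integral>\<^sup>+y. ennreal (dist (sph x) (sph y) powr (- \<beta>)) \<partial>\<mu>) \<le> ennreal J"
          using J[of x] by (simp add: \<mu>_def nn_integral_restrict_space)
      qed
      also have "ennreal K * \<dots> < \<infinity>" by (simp add: em ennreal_mult_less_top)
      finally show ?thesis by (simp add: mult_left_mono)
    qed
    have "(\<lambda>\<omega>. \<integral>\<^sup>+z. ennreal (d \<omega> (fst z) (snd z) powr (- s)) \<partial>(\<mu> \<Otimes>\<^sub>M \<mu>)) \<in> borel_measurable M"
    proof -
      interpret \<mu>\<mu>: pair_sigma_finite \<mu> \<mu> ..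
      show ?thesis using \<mu>\<mu>.borel_measurable_nn_integral_fst[OF e3] by simp
    qed
    then have "AE \<omega> in M. (\<integral>\<^sup>+z. ennreal (d \<omega> (fst z) (snd z) powr (- s)) \<partial>(\<mu> \<Otimes>\<^sub>M \<mu>)) \<noteq> \<infinity>"
      using total by (intro nn_integral_PInf_AE) auto
    with YX cont show "AE \<omega> in M. \<forall>\<delta> Z. \<delta> < s \<longrightarrow>
        (\<lambda>x. (sph x, X (sph x) \<omega>)) ` ({p1..q1} \<times> {p2..q2}) \<subseteq> Z \<longrightarrow> hausdorff_measure \<delta> Z = \<infinity>"
    proof eventually_elim
      case (elim \<omega>)
      define G where "G x = (sph x, X (sph x) \<omega>)" for x
      have "continuous_on UNIV G"
        unfolding G_def by (intro continuous_intros sph_continuous_comp elim)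
      then have Gb: "G \<in> borel_measurable borel" by (rule borel_measurable_continuous_onI)
      have G[measurable]: "G \<in> borel_measurable \<mu>" by (rule measurable_compose[OF id\<mu> Gb])
      have dG: "d \<omega> x y = dist (G x) (G y)" for x y
        using elim(1) unfolding d_def G_def by metis
      have gm: "(\<lambda>z. ennreal (dist (G (fst z)) (G (snd z)) powr (- s))) \<in> borel_measurable (\<mu> \<Otimes>\<^sub>M \<mu>)"
        by measurable
      have energy: "(\<integral>\<^sup>+x. \<integral>\<^sup>+y. ennreal (dist (G x) (G y) powr (- s)) \<partial>\<mu> \<partial>\<mu>) < \<infinity>"
        using elim(3) \<mu>.nn_integral_fst[OF gm] by (simp add: dG less_top)
      \<comment> \<open>The first component of \<open>G\<close> is already injective on
        \<open>Q\<close>, so each fibre is a single point.\<close>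
      have null: "AE y in \<mu>. G y \<noteq> G x" if "x \<in> space \<mu>" for x
      proof -
        have "AE y in lborel. y \<in> Q \<longrightarrow> G y \<noteq> G x"
          using AE_lborel_singleton[of x]
        proof eventually_elim
          case (elim y)
          then show ?case using inj[of y x] that unfolding G_def sp by blast
        qed
        then show ?thesis unfolding \<mu>_def by (subst AE_restrict_space_iff) auto
      qed
      have pos: "emeasure \<mu> (space \<mu>) > 0" using Q0 by (simp add: em)
      show ?case
      proof (intro allI impI)
        fix \<delta> :: real and Z assume "\<delta> < s" "(\<lambda>x. (sph x, X (sph x) \<omega>)) ` ({p1..q1} \<times> {p2..q2}) \<subseteq> Z"
        then show "hausdorff_measure \<delta> Z = \<infinity>"
          using s by (intro hausdorff_measure_eq_top_of_energy[OF \<mu>.sigma_finite_measure_axioms G pos null energy])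
            (auto simp: sp Q_def G_def)
      qed
    qed
  qed
qed

lemma (in prob_space) AE_hausdorff_measure_truncated_surface_eq_top:
  assumes field: "gaussian_field M S2 X" and iso: "isotropic M X" and frac: "has_fractal_index M X \<alpha>"
    and \<alpha>: "\<alpha> \<le> 2" and cont: "AE \<omega> in M. continuous_on S2 (\<lambda>u. X u \<omega>)"
    and s: "1 < s" "s < 3 - \<alpha> / 2"
  shows "AE \<omega> in M. \<forall>\<delta>. \<delta> < s \<longrightarrow> (\<exists>u\<in>S2. X u \<omega> > c) \<longrightarrow>
    hausdorff_measure \<delta> (truncated_surface c (\<lambda>u. X u \<omega>)) = \<infinity>"
proof -
  define P where "P p1 q1 p2 q2 \<omega> \<longleftrightarrow> (\<forall>\<delta> Z. \<delta> < s \<longrightarrow>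
    (\<lambda>x. (sph x, X (sph x) \<omega>)) ` ({p1..q1} \<times> {p2..q2}) \<subseteq> Z \<longrightarrow> hausdorff_measure \<delta> Z = \<infinity>)"
    for p1 q1 p2 q2 :: real and \<omega>
  define ok where "ok r p1 q1 p2 q2 \<longleftrightarrow> 0 < p1 \<and> p1 < q1 \<and> q1 < pi \<and> p2 < q2 \<and> q1 - p1 < r \<and> q2 - p2 < r"
    for r p1 q1 p2 q2 :: real
  obtain r where r: "r > 0" and rect: "\<And>p1 q1 p2 q2. ok r p1 q1 p2 q2 \<Longrightarrow> AE \<omega> in M. P p1 q1 p2 q2 \<omega>"
    unfolding P_def ok_def
    by (rule AE_hausdorff_measure_graph_rectangle_eq_top[OF field iso frac \<alpha> cont s]) (use that in blast)
  have "AE \<omega> in M. \<forall>p1 q1 p2 q2 :: rat.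
      ok r (of_rat p1) (of_rat q1) (of_rat p2) (of_rat q2) \<longrightarrow> P (of_rat p1) (of_rat q1) (of_rat p2) (of_rat q2) \<omega>"
    unfolding AE_all_countable by (intro allI) (use rect in \<open>auto intro: AE_I2\<close>)
  with cont show ?thesis
  proof eventually_elim
    case (elim \<omega>)
    show ?case
    proof (intro allI impI)
      fix \<delta> assume \<delta>: "\<delta> < s" and "\<exists>u\<in>S2. X u \<omega> > c"
      then obtain u where u: "u \<in> S2" "X u \<omega> > c" by blast
      obtain a b where ab: "0 \<le> a" "a \<le> pi" "u = sph (a, b)" using sph_surj[OF u(1)] .
      have "open {p. c < X (sph p) \<omega>}"
        using sph_continuous_comp[OF elim(1)] by (intro open_Collect_less continuous_intros)
      then obtain e where e: "e > 0" "\<And>p. dist p (a, b) < e \<Longrightarrow> c < X (sph p) \<omega>"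
        using u(2) unfolding open_dist ab(3) by blast
      \<comment> \<open>Sides will stay below \<open>t\<close>, hence below \<open>r\<close>; points
        will stay within \<open>t\<close> in each coordinate, hence within \<open>2 * t < e\<close>
        in distance.\<close>
      define t where "t = min (e / 4) (r / 2)"
      have t: "t > 0" "t \<le> e / 4" "t \<le> r / 2" using e r by (auto simp: t_def)
      \<comment> \<open>The point \<open>u\<close> may be a pole, where the chart degenerates, so
        the polar angle is first moved to some \<open>a1\<close> strictly between 0 and
        \<open>pi\<close>.\<close>
      have "max 0 (a - t / 2) < min pi (a + t / 2)" using ab t by auto
      then obtain a1 where a1: "max 0 (a - t / 2) < a1" "a1 < min pi (a + t / 2)" using dense by blast
      obtain p1 where p1: "max 0 (a1 - t / 2) < of_rat p1" "of_rat p1 < a1"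
        using of_rat_dense[of "max 0 (a1 - t / 2)" a1] a1 t by auto
      obtain q1 where q1: "a1 < of_rat q1" "of_rat q1 < min pi (a1 + t / 2)"
        using of_rat_dense[of a1 "min pi (a1 + t / 2)"] a1 t by auto
      obtain p2 where p2: "b - t / 2 < of_rat p2" "of_rat p2 < b"
        using of_rat_dense[of "b - t / 2" b] t by auto
      obtain q2 where q2: "b < of_rat q2" "of_rat q2 < b + t / 2"
        using of_rat_dense[of b "b + t / 2"] t by auto
      have "ok r (of_rat p1) (of_rat q1) (of_rat p2) (of_rat q2)"
        using p1 q1 p2 q2 t unfolding ok_def by auto
      then have "P (of_rat p1) (of_rat q1) (of_rat p2) (of_rat q2) \<omega>" using elim(2) by blast
      moreover have "(\<lambda>x. (sph x, X (sph x) \<omega>)) ` ({of_rat p1..of_rat q1} \<times> {of_rat p2..of_rat q2}) \<subseteq>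
          truncated_surface c (\<lambda>u. X u \<omega>)"
      proof
        fix z assume "z \<in> (\<lambda>x. (sph x, X (sph x) \<omega>)) ` ({of_rat p1..of_rat q1} \<times> {of_rat p2..of_rat q2})"
        then obtain a' b' where z: "z = (sph (a', b'), X (sph (a', b')) \<omega>)"
          "of_rat p1 \<le> a'" "a' \<le> of_rat q1" "of_rat p2 \<le> b'" "b' \<le> of_rat q2" by auto
        have "\<bar>a' - a\<bar> < t" "\<bar>b' - b\<bar> < t" using z p1 q1 p2 q2 a1 t by (auto simp: abs_less_iff)
        then have "dist (a', b') (a, b) < e"
          using sqrt_sum_squares_le_sum_abs[of "a' - a" "b' - b"] t by (simp add: dist_Pair_Pair dist_real_def)
        then have "c < X (sph (a', b')) \<omega>" by (rule e(2))
        then show "z \<in> truncated_surface c (\<lambda>u. X u \<omega>)"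
          unfolding truncated_surface_def z using sph_in_S2 by (intro image_eqI[of _ _ "sph (a', b')"]) auto
      qed
      ultimately show "hausdorff_measure \<delta> (truncated_surface c (\<lambda>u. X u \<omega>)) = \<infinity>"
        using \<delta> unfolding P_def by blast
    qed
  qed
qed

section \<open>The flat alternative and the conclusion\<close>

text \<open>A constant height has no oscillation, so the covering estimate applies with
  \<open>\<gamma> = 1\<close> and \<open>K = 0\<close>, and its threshold 3 - 1 meets the lower
  bound.\<close>

lemma flat_graph_has_hausdorff_dim: "(S2 \<times> {c::real}) has_hausdorff_dim 2"
proof -
  have "hausdorff_measure \<delta> (S2 \<times> {c}) = 0" if "\<delta> > 2" for \<delta>
  proof -
    have "(\<lambda>u. (u, c)) ` S2 = S2 \<times> {c}" by auto
    then show ?thesis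
      using hausdorff_measure_dyadic_oscillation_eq_0[of 1 \<delta> 0 "\<lambda>_. c"] that by simp
  qed
  then show ?thesis
    unfolding has_hausdorff_dim_def using hausdorff_measure_flat_graph_eq_top by auto
qed

lemma radial_point_flat_graph:
  assumes "c > 0" shows "radial_point ` (S2 \<times> {c}) = sphere 0 c"
proof
  show "radial_point ` (S2 \<times> {c}) \<subseteq> sphere 0 c" using assms by (auto simp: radial_point_def)
  show "sphere 0 c \<subseteq> radial_point ` (S2 \<times> {c})"
  proof
    fix x :: "real^3" assume "x \<in> sphere 0 c"
    then show "x \<in> radial_point ` (S2 \<times> {c})"
      using assms by (intro image_eqI[of _ _ "(x /\<^sub>R c, c)"]) (auto simp: radial_point_def)
  qed
qed

text \<open>Finite-dimensional laws do not determine paths, whence the assumption that almost every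
  path is continuous; the maximum over the sphere is then attained and equals the supremum written
  here.\<close>

theorem theorem3p1:
  fixes M :: "'w measure" and X :: "real^3 \<Rightarrow> 'w \<Rightarrow> real" and \<alpha> c :: real
  assumes "prob_space M"
    and "gaussian_field M S2 X"
    and "isotropic M X"
    and "has_fractal_index M X \<alpha>" and "\<alpha> \<in> {0<..2}"
    and continuous_paths: "AE \<omega> in M. continuous_on S2 (\<lambda>u. X u \<omega>)"
    and "c > 0"
  shows "AE \<omega> in M.
    ((SUP u\<in>S2. X u \<omega>) \<le> c \<longrightarrow>
       truncated_surface c (\<lambda>u. X u \<omega>) = S2 \<times> {c} \<and>
       radial_point ` truncated_surface c (\<lambda>u. X u \<omega>) = sphere 0 c \<and>
       truncated_surface c (\<lambda>u. X u \<omega>) has_hausdorff_dim 2) \<and>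
    ((SUP u\<in>S2. X u \<omega>) > c \<longrightarrow>
       truncated_surface c (\<lambda>u. X u \<omega>) has_hausdorff_dim (3 - \<alpha> / 2))"
proof -
  interpret prob_space M by fact
  have \<alpha>: "0 < \<alpha>" "\<alpha> \<le> 2" using assms(5) by auto
  let ?Z = "\<lambda>\<omega>. truncated_surface c (\<lambda>u. X u \<omega>)"
  \<comment> \<open>Each exponent has its own null set, so only rational ones are used;
    \<open>\<alpha> \<le> 2\<close> ensures that they are at most 1.\<close>
  have "AE \<omega> in M. 0 < real_of_rat q \<and> real_of_rat q < \<alpha> / 2 \<longrightarrow>
      (\<forall>\<delta>. \<delta> > 3 - real_of_rat q \<longrightarrow> hausdorff_measure \<delta> (?Z \<omega>) = 0)" for q
  proof (cases "0 < real_of_rat q \<and> real_of_rat q < \<alpha> / 2")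
    case True
    have q: "0 < real_of_rat q" "real_of_rat q \<le> 1" "real_of_rat q < \<alpha> / 2"
      using True \<alpha> by linarith+
    show ?thesis
      using AE_hausdorff_measure_truncated_surface_eq_0[OF assms(2-4) continuous_paths q, of c]
      by eventually_elim blast
  qed (rule AE_I2, blast)
  then have upper: "AE \<omega> in M. \<forall>q. 0 < real_of_rat q \<and> real_of_rat q < \<alpha> / 2 \<longrightarrow>
      (\<forall>\<delta>. \<delta> > 3 - real_of_rat q \<longrightarrow> hausdorff_measure \<delta> (?Z \<omega>) = 0)"
    by (simp add: AE_all_countable)
  have "AE \<omega> in M. 1 < real_of_rat q \<and> real_of_rat q < 3 - \<alpha> / 2 \<longrightarrow>
      (\<forall>\<delta>. \<delta> < real_of_rat q \<longrightarrow> (\<exists>u\<in>S2. X u \<omega> > c) \<longrightarrow> hausdorff_measure \<delta> (?Z \<omega>) = \<infinity>)" for q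
    using AE_hausdorff_measure_truncated_surface_eq_top[OF assms(2-4) \<alpha>(2) continuous_paths, of "real_of_rat q" c]
    by (cases "1 < real_of_rat q \<and> real_of_rat q < 3 - \<alpha> / 2") auto
  then have lower: "AE \<omega> in M. \<forall>q. 1 < real_of_rat q \<and> real_of_rat q < 3 - \<alpha> / 2 \<longrightarrow>
      (\<forall>\<delta>. \<delta> < real_of_rat q \<longrightarrow> (\<exists>u\<in>S2. X u \<omega> > c) \<longrightarrow> hausdorff_measure \<delta> (?Z \<omega>) = \<infinity>)"
    by (simp add: AE_all_countable)
  from continuous_paths upper lower show ?thesis
  proof eventually_elim
    case (elim \<omega>)
    have bdd: "bdd_above ((\<lambda>u. X u \<omega>) ` S2)"
      using elim(1) by (intro bounded_imp_bdd_above compact_imp_bounded compact_continuous_image) auto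
    have ne: "S2 \<noteq> {}" using sph_in_S2 by blast
    show ?case
    proof (intro conjI impI)
      assume le: "(SUP u\<in>S2. X u \<omega>) \<le> c"
      have "X u \<omega> \<le> c" if "u \<in> S2" for u
        using cSUP_upper[OF that bdd] le by linarith
      then show flat: "?Z \<omega> = S2 \<times> {c}" unfolding truncated_surface_def by (auto simp: max_absorb1)
      show "radial_point ` ?Z \<omega> = sphere 0 c" unfolding flat by (rule radial_point_flat_graph[OF \<open>c > 0\<close>])
      show "?Z \<omega> has_hausdorff_dim 2" unfolding flat by (rule flat_graph_has_hausdorff_dim)
    next
      assume "(SUP u\<in>S2. X u \<omega>) > c"
      then have ex: "\<exists>u\<in>S2. X u \<omega> > c" using less_cSUP_iff[OF ne bdd] by blast
      have "hausdorff_measure \<delta> (?Z \<omega>) = \<infinity>" if "\<delta> < 3 - \<alpha> / 2" for \<delta>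
      proof -
        \<comment> \<open>The lower bound is available for orders above 1, and
          \<open>\<alpha> \<le> 2\<close> leaves room there; the maximum treats small
          \<open>\<delta>\<close> along with the rest.\<close>
        have "max 1 \<delta> < 3 - \<alpha> / 2" using that \<alpha> by simp
        then obtain q where "max 1 \<delta> < real_of_rat q" "real_of_rat q < 3 - \<alpha> / 2"
          using of_rat_dense by blast
        then have "1 < real_of_rat q" "\<delta> < real_of_rat q" "real_of_rat q < 3 - \<alpha> / 2" by linarith+
        then show ?thesis using elim(3) ex by blast
      qed
      moreover have "hausdorff_measure \<delta> (?Z \<omega>) = 0" if "\<delta> > 3 - \<alpha> / 2" for \<delta>
      proof -
        \<comment> \<open>The maximum with 0 keeps the Hoelder exponent positive when
          \<open>\<delta>\<close> exceeds 3.\<close>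
        have "max 0 (3 - \<delta>) < \<alpha> / 2" using that \<alpha> by (auto simp: max_def)
        then obtain q where q: "max 0 (3 - \<delta>) < real_of_rat q" "real_of_rat q < \<alpha> / 2"
          using of_rat_dense by blast
        then have "\<delta> > 3 - real_of_rat q" "0 < real_of_rat q" by linarith+
        then show ?thesis using elim(2) q(2) by blast
      qed
      ultimately show "?Z \<omega> has_hausdorff_dim (3 - \<alpha> / 2)"
        unfolding has_hausdorff_dim_def using \<alpha> by auto
    qed
  qed
qed

end
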